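(* Let $(X,\mathsf d)$ be a complete and separable metric space and $n,m\ge1$. For every $v\in\mathcal D^n(X)$ and $w\in\mathcal D^m(X)$ it holds $$\|v\wedge w\|\le\|v\|\,\|w\|,$$ where the three norms are those of $\mathcal D^{n+m}(X)$, $\mathcal D^n(X)$ and $\mathcal D^m(X)$ respectively.
   Context: $\mathrm{LIP}(X)$, $\mathrm{LIP}_b(X)$ denote the Lipschitz and the bounded Lipschitz real functions on $X$, $\mathrm{Lip}(\pi)$ the Lipschitz constant. For $k\ge1$, a $k$-current is a multilinear map $T:\mathrm{LIP}_b(X)\times\mathrm{LIP}(X)^k\to\mathbb R$ such that: (i) there is a finite positive Borel measure $\mu$ with $|T(f,\pi_1,\dots,\pi_k)|\le\prod_j\mathrm{Lip}(\pi_j)\int_X|f|\,\mathrm d\mu$ for all $f\in\mathrm{LIP}_b(X)$, $\pi_j\in\mathrm{LIP}(X)$; the minimal such $\mu$ (which exists) is the mass $\|T\|_{\mathrm{AK}}$; (ii) if $f\in\mathrm{LIP}_b(X)$ and, for $j=1,\dots,k$, $\{\pi_j^i\}_i\subseteq\mathrm{LIP}(X)$ is a sequence of equi-Lipschitz functions with $\pi^i_j\to\pi_j$ pointwise, then $\lim_iT(f,\pi_1^i,\dots,\pi_k^i)=T(f,\pi_1,\dots,\pi_k)$; (iii) if $f\in\mathrm{LIP}_b(X)$ and for some $j$ the function $\pi_j$ is constant on a neighbourhood of $\{f\ne0\}$, then $T(f,\pi_1,\dots,\pi_k)=0$. By (i), $T$ extends uniquely to $C_b(X)\times\mathrm{LIP}(X)^k$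 still satisfying the inequality in (i); it is alternating in the last $k$ entries, hence is regarded as a linear map on the algebraic tensor product (over $\mathbb R$) $C_b(X)\otimes\bigwedge^k\mathrm{LIP}(X)$, where $f\,\mathrm d\pi_1\wedge\dots\wedge\mathrm d\pi_k$ denotes the image of $(f,\pi_1,\dots,\pi_k)$. $\mathcal D^k(X)$ is $C_b(X)\otimes\bigwedge^k\mathrm{LIP}(X)$ with the seminorm $\|v\|:=\sup\{T(v):T\ k\text{-current},\ \|T\|_{\mathrm{AK}}(X)\le1\}$, elements being identified when they differ by an element of zero seminorm. The product $\wedge:\mathcal D^n(X)\times\mathcal D^m(X)\to\mathcal D^{n+m}(X)$, $v\wedge w:=\wedge(v,w)$, is defined on representatives by bilinear extension of $$(f\,\mathrm d\pi_1\wedge\dots\wedge\mathrm d\pi_n,\ g\,\mathrm d\pi_{n+1}\wedge\dots\wedge\mathrm d\pi_{n+m})\mapsto fg\,\mathrm d\pi_1\wedge\dots\wedge\mathrm d\pi_n\wedge\mathrm d\pi_{n+1}\wedge\dots\wedge\mathrm d\pi_{n+m}.$$ The inequality is understood for the seminorms of arbitrary representatives. *)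

theory Defs
  imports "HOL-Analysis.Analysis"
begin

section \<open>Lipschitz functions\<close>

definition LIP :: "('a::metric_space \<Rightarrow> real) set" where
  "LIP = {f. \<exists>L. L-lipschitz_on UNIV f}"

definition LIPb :: "('a::metric_space \<Rightarrow> real) set" where
  "LIPb = {f \<in> LIP. bounded (range f)}"

definition Lip :: "('a::metric_space \<Rightarrow> real) \<Rightarrow> real" where
  "Lip f = Inf {L. L-lipschitz_on UNIV f}"

definition LIP_tuples :: "nat \<Rightarrow> ('a::metric_space \<Rightarrow> real) list set" where
  "LIP_tuples k = {\<pi>s. length \<pi>s = k \<and> set \<pi>s \<subseteq> LIP}"


section \<open>Metric currents\<close>

text \<open>A candidate current is a function on all pairs of a real function and a list of real
  functions; only its values on \<^term>\<open>LIPb \<times> LIP_tuples k\<close> are ever used.\<close>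

definition multilinear :: "nat \<Rightarrow> (('a::metric_space \<Rightarrow> real) \<Rightarrow> ('a \<Rightarrow> real) list \<Rightarrow> real) \<Rightarrow> bool" where
  "multilinear k T \<longleftrightarrow>
    (\<forall>f\<in>LIPb. \<forall>g\<in>LIPb. \<forall>\<pi>s\<in>LIP_tuples k. \<forall>a b.
       T (\<lambda>x. a * f x + b * g x) \<pi>s = a * T f \<pi>s + b * T g \<pi>s) \<and>
    (\<forall>f\<in>LIPb. \<forall>\<pi>s p q \<rho>s a b.
       \<pi>s @ p # \<rho>s \<in> LIP_tuples k \<longrightarrow> q \<in> LIP \<longrightarrow>
       T f (\<pi>s @ (\<lambda>x. a * p x + b * q x) # \<rho>s)
         = a * T f (\<pi>s @ p # \<rho>s) + b * T f (\<pi>s @ q # \<rho>s))"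

definition mass_bound ::
    "nat \<Rightarrow> (('a::metric_space \<Rightarrow> real) \<Rightarrow> ('a \<Rightarrow> real) list \<Rightarrow> real) \<Rightarrow> 'a measure \<Rightarrow> bool" where
  "mass_bound k T \<mu> \<longleftrightarrow>
    finite_measure \<mu> \<and> sets \<mu> = sets borel \<and>
    (\<forall>f\<in>LIPb. \<forall>\<pi>s\<in>LIP_tuples k. \<bar>T f \<pi>s\<bar> \<le> (\<Prod>j<k. Lip (\<pi>s ! j)) * (\<integral>x. \<bar>f x\<bar> \<partial>\<mu>))"

definition current :: "nat \<Rightarrow> (('a::metric_space \<Rightarrow> real) \<Rightarrow> ('a \<Rightarrow> real) list \<Rightarrow> real) \<Rightarrow> bool" where
  "current k T \<longleftrightarrow>
    k \<ge> 1 \<and>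
    multilinear k T \<and>
    (\<exists>\<mu>. mass_bound k T \<mu>) \<and>
    (\<forall>f\<in>LIPb. \<forall>\<pi>s\<in>LIP_tuples k. \<forall>p::nat \<Rightarrow> ('a \<Rightarrow> real) list.
       (\<forall>i. p i \<in> LIP_tuples k) \<longrightarrow>
       (\<forall>j<k. \<exists>L. \<forall>i. L-lipschitz_on UNIV (p i ! j)) \<longrightarrow>
       (\<forall>j<k. \<forall>x. (\<lambda>i. (p i ! j) x) \<longlonglongrightarrow> (\<pi>s ! j) x) \<longrightarrow>
       (\<lambda>i. T f (p i)) \<longlonglongrightarrow> T f \<pi>s) \<and>
    (\<forall>f\<in>LIPb. \<forall>\<pi>s\<in>LIP_tuples k.
       (\<exists>j<k. \<exists>U c. open U \<and> {x. f x \<noteq> 0} \<subseteq> U \<and> (\<forall>x\<in>U. (\<pi>s ! j) x = c)) \<longrightarrow>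
       T f \<pi>s = 0)"

definition AK_mass ::
    "nat \<Rightarrow> (('a::metric_space \<Rightarrow> real) \<Rightarrow> ('a \<Rightarrow> real) list \<Rightarrow> real) \<Rightarrow> 'a measure" where
  "AK_mass k T = (THE \<mu>. mass_bound k T \<mu> \<and>
     (\<forall>\<nu>. mass_bound k T \<nu> \<longrightarrow> (\<forall>A\<in>sets borel. emeasure \<mu> A \<le> emeasure \<nu> A)))"


section \<open>The tensor product of $C_b(X)$ with the exterior powers of LIP(X)\<close>

text \<open>Elements are represented by finite formal sums of generators
  $f \otimes \pi_1 \wedge \dots \wedge \pi_k$, i.e. by finite multisets of pairs of a bounded
  continuous function \<open>f\<close> and a list of Lipschitz functions. Real coefficients are absorbed
  in \<open>f\<close>. All degrees are treated at once: the quotient below is the tensor product of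
  $C_b(X)$ with the whole exterior algebra of LIP(X), which is graded by the length of the
  lists; see \<open>forms\<close> for the homogeneous pieces. The relation is the least congruence
  containing the defining relations of this tensor product.\<close>

type_synonym 'a presum = "(('a \<Rightarrow> real) \<times> ('a \<Rightarrow> real) list) multiset"

definition is_presum :: "'a::metric_space presum \<Rightarrow> bool" where
  "is_presum v \<longleftrightarrow> (\<forall>(f, \<pi>s) \<in># v. f \<in> bcontfun \<and> set \<pi>s \<subseteq> LIP)"

inductive tensor_eq :: "'a::metric_space presum \<Rightarrow> 'a presum \<Rightarrow> bool" where
  refl: "is_presum v \<Longrightarrow> tensor_eq v v"
| sym: "tensor_eq v w \<Longrightarrow> tensor_eq w v"
| trans: "tensor_eq u v \<Longrightarrow> tensor_eq v w \<Longrightarrow> tensor_eq u w"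
| plus: "tensor_eq v v' \<Longrightarrow> tensor_eq w w' \<Longrightarrow> tensor_eq (v + w) (v' + w')"
| zero: "set \<pi>s \<subseteq> LIP \<Longrightarrow> tensor_eq {#(\<lambda>x. 0, \<pi>s)#} {#}"
| add_coeff: "f \<in> bcontfun \<Longrightarrow> g \<in> bcontfun \<Longrightarrow> set \<pi>s \<subseteq> LIP \<Longrightarrow>
    tensor_eq {#(\<lambda>x. f x + g x, \<pi>s)#} {#(f, \<pi>s), (g, \<pi>s)#}"
| add_slot: "f \<in> bcontfun \<Longrightarrow> set (\<pi>s @ p # q # \<rho>s) \<subseteq> LIP \<Longrightarrow>
    tensor_eq {#(f, \<pi>s @ (\<lambda>x. p x + q x) # \<rho>s)#} {#(f, \<pi>s @ p # \<rho>s), (f, \<pi>s @ q # \<rho>s)#}"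
| scale: "f \<in> bcontfun \<Longrightarrow> set (\<pi>s @ p # \<rho>s) \<subseteq> LIP \<Longrightarrow>
    tensor_eq {#(\<lambda>x. c * f x, \<pi>s @ p # \<rho>s)#} {#(f, \<pi>s @ (\<lambda>x. c * p x) # \<rho>s)#}"
| alternating: "f \<in> bcontfun \<Longrightarrow> set (\<pi>s @ p # \<rho>s @ p # \<sigma>s) \<subseteq> LIP \<Longrightarrow>
    tensor_eq {#(f, \<pi>s @ p # \<rho>s @ p # \<sigma>s)#} {#}"

lemma is_presum_simps [simp]:
  "is_presum {#}"
  "is_presum (v + w) \<longleftrightarrow> is_presum v \<and> is_presum w"
  "is_presum (add_mset (f, \<pi>s) v) \<longleftrightarrow> f \<in> bcontfun \<and> set \<pi>s \<subseteq> LIP \<and> is_presum v"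
  by (auto simp: is_presum_def)

lemma LIP_add: "f \<in> LIP \<Longrightarrow> g \<in> LIP \<Longrightarrow> (\<lambda>x. f x + g x) \<in> LIP"
  unfolding LIP_def using lipschitz_on_add by blast

lemma LIP_cmult: "f \<in> LIP \<Longrightarrow> (\<lambda>x. c * f x) \<in> LIP"
  unfolding LIP_def using lipschitz_on_cmult_real by blast

lemma bcontfun_const_real [simp]: "(\<lambda>x. c :: real) \<in> bcontfun"
  by (simp add: bcontfun_def)

lemma bcontfun_add_real:
  fixes f g :: "'a::metric_space \<Rightarrow> real"
  shows "f \<in> bcontfun \<Longrightarrow> g \<in> bcontfun \<Longrightarrow> (\<lambda>x. f x + g x) \<in> bcontfun"
  by (auto simp: bcontfun_def intro!: continuous_intros bounded_plus_comp)

lemma bcontfun_mult_real: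
  fixes f g :: "'a::metric_space \<Rightarrow> real"
  assumes "f \<in> bcontfun" "g \<in> bcontfun"
  shows "(\<lambda>x. f x * g x) \<in> bcontfun"
proof -
  obtain B where B: "\<And>x. \<bar>f x\<bar> \<le> B" using assms(1) by (auto simp: bcontfun_def bounded_iff)
  obtain C where C: "\<And>x. \<bar>g x\<bar> \<le> C" using assms(2) by (auto simp: bcontfun_def bounded_iff)
  have "\<bar>f x * g x\<bar> \<le> B * C" for x
    unfolding abs_mult by (intro mult_mono B C) (use order_trans[OF abs_ge_zero B] in auto)
  then have "bounded (range (\<lambda>x. f x * g x))" by (auto simp: bounded_iff)
  then show ?thesis using assms by (auto simp: bcontfun_def intro!: continuous_intros)
qed

lemma tensor_eq_is_presum: "tensor_eq v w \<Longrightarrow> is_presum v \<and> is_presum w"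
  by (induction rule: tensor_eq.induct)
    (auto simp: LIP_add LIP_cmult bcontfun_add_real bcontfun_mult_real)

lemma tensor_eq_refl_iff: "tensor_eq v v \<longleftrightarrow> is_presum v"
  using tensor_eq.refl tensor_eq_is_presum by blast

lemma part_equivp_tensor_eq: "part_equivp tensor_eq"
proof (rule part_equivpI)
  show "\<exists>v. tensor_eq v v" by (rule exI[of _ "{#}"]) (simp add: tensor_eq.refl)
  show "symp tensor_eq" by (rule sympI) (rule tensor_eq.sym)
  show "transp tensor_eq" by (rule transpI) (rule tensor_eq.trans)
qed

quotient_type (overloaded) 'a tensor = "'a::metric_space presum" / partial: tensor_eq
  by (rule part_equivp_tensor_eq)

definition scale_presum :: "real \<Rightarrow> 'a presum \<Rightarrow> 'a presum" where
  "scale_presum c v = image_mset (\<lambda>(f, \<pi>s). (\<lambda>x. c * f x, \<pi>s)) v"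

definition wedge_presum :: "'a presum \<Rightarrow> 'a presum \<Rightarrow> 'a presum" where
  "wedge_presum v w =
     \<Sum>\<^sub># (image_mset (\<lambda>(f, \<pi>s). image_mset (\<lambda>(g, \<rho>s). (\<lambda>x. f x * g x, \<pi>s @ \<rho>s)) w) v)"

lemma scale_presum_simps [simp]:
  "scale_presum c {#} = {#}"
  "scale_presum c (v + w) = scale_presum c v + scale_presum c w"
  "scale_presum c (add_mset (f, \<pi>s) v) = add_mset (\<lambda>x. c * f x, \<pi>s) (scale_presum c v)"
  by (auto simp: scale_presum_def)

lemma wedge_presum_simps:
  "wedge_presum {#} w = {#}"
  "wedge_presum v {#} = {#}"
  "wedge_presum (v + v') w = wedge_presum v w + wedge_presum v' w"
  "wedge_presum v (w + w') = wedge_presum v w + wedge_presum v w'"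
  "wedge_presum {#(f, \<pi>s)#} {#(g, \<rho>s)#} = {#(\<lambda>x. f x * g x, \<pi>s @ \<rho>s)#}"
proof -
  show *: "wedge_presum v (w + w') = wedge_presum v w + wedge_presum v w'" for w w' :: "'a presum"
    by (induction v) (auto simp: wedge_presum_def)
  show "wedge_presum v {#} = {#}"
    by (induction v) (auto simp: wedge_presum_def)
qed (auto simp: wedge_presum_def)

lemma wedge_presum_add_mset_left:
  "wedge_presum (add_mset x v) w = wedge_presum {#x#} w + wedge_presum v w"
  using wedge_presum_simps(3)[of "{#x#}" v w] by simp

lemma wedge_presum_add_mset_right:
  "wedge_presum v (add_mset x w) = wedge_presum v {#x#} + wedge_presum v w"
  using wedge_presum_simps(4)[of v "{#x#}" w] by simp

lemma scale_presum_cong: "tensor_eq v w \<Longrightarrow> tensor_eq (scale_presum c v) (scale_presum c w)"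
proof (induction rule: tensor_eq.induct)
  case (refl v)
  then have "is_presum (scale_presum c v)"
    by (induction v) (auto simp: bcontfun_mult_real)
  then show ?case by (rule tensor_eq.refl)
next
  case (add_coeff f g \<pi>s)
  then show ?case
    using tensor_eq.add_coeff[of "\<lambda>x. c * f x" "\<lambda>x. c * g x" \<pi>s]
    by (simp add: bcontfun_mult_real distrib_left)
next
  case (scale f \<pi>s p \<rho>s d)
  then show ?case
    using tensor_eq.scale[of "\<lambda>x. c * f x" \<pi>s p \<rho>s d]
    by (simp add: bcontfun_mult_real mult.left_commute)
next
  case (sym v w)
  then show ?case by (blast intro: tensor_eq.sym)
next
  case (trans u v w)
  then show ?case by (blast intro: tensor_eq.trans)
next
  case (zero \<pi>s)
  then show ?case by (simp add: tensor_eq.zero)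
qed (simp_all add: tensor_eq.plus tensor_eq.add_slot tensor_eq.alternating bcontfun_mult_real)

lemma wedge_presum_cong_left1:
  assumes "tensor_eq v v'" and [simp]: "g \<in> bcontfun" "set \<sigma>s \<subseteq> LIP"
  shows "tensor_eq (wedge_presum v {#(g, \<sigma>s)#}) (wedge_presum v' {#(g, \<sigma>s)#})"
  using assms(1)
proof (induction rule: tensor_eq.induct)
  case (refl v)
  then have "is_presum (wedge_presum v {#(g, \<sigma>s)#})"
    by (induction v) (auto simp: wedge_presum_def bcontfun_mult_real)
  then show ?case by (rule tensor_eq.refl)
next
  case (sym v w)
  then show ?case by (blast intro: tensor_eq.sym)
next
  case (trans u v w)
  then show ?case by (blast intro: tensor_eq.trans)
next
  case (plus v v' w w')
  then show ?case by (simp add: wedge_presum_simps tensor_eq.plus)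
next
  case (zero \<pi>s)
  then show ?case by (simp add: wedge_presum_simps tensor_eq.zero)
next
  case (add_coeff f f' \<pi>s)
  then show ?case
    using tensor_eq.add_coeff[of "\<lambda>x. f x * g x" "\<lambda>x. f' x * g x" "\<pi>s @ \<sigma>s"]
    by (simp add: wedge_presum_def bcontfun_mult_real distrib_right add_mset_commute)
next
  case (add_slot f \<pi>s p q \<rho>s)
  then show ?case
    using tensor_eq.add_slot[of "\<lambda>x. f x * g x" \<pi>s p q "\<rho>s @ \<sigma>s"]
    by (simp add: wedge_presum_def bcontfun_mult_real add_mset_commute)
next
  case (scale f \<pi>s p \<rho>s c)
  then show ?case
    using tensor_eq.scale[of "\<lambda>x. f x * g x" \<pi>s p "\<rho>s @ \<sigma>s" c]
    by (simp add: wedge_presum_def bcontfun_mult_real mult.assoc)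
next
  case (alternating f \<pi>s p \<rho>s \<tau>s)
  then show ?case
    using tensor_eq.alternating[of "\<lambda>x. f x * g x" \<pi>s p \<rho>s "\<tau>s @ \<sigma>s"]
    by (simp add: wedge_presum_def bcontfun_mult_real)
qed

lemma wedge_presum_cong_right1:
  assumes "tensor_eq v v'" and [simp]: "g \<in> bcontfun" "set \<sigma>s \<subseteq> LIP"
  shows "tensor_eq (wedge_presum {#(g, \<sigma>s)#} v) (wedge_presum {#(g, \<sigma>s)#} v')"
  using assms(1)
proof (induction rule: tensor_eq.induct)
  case (refl v)
  then have "is_presum (wedge_presum {#(g, \<sigma>s)#} v)"
    by (induction v) (auto simp: wedge_presum_def bcontfun_mult_real)
  then show ?case by (rule tensor_eq.refl)
next
  case (sym v w)
  then show ?case by (blast intro: tensor_eq.sym)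
next
  case (trans u v w)
  then show ?case by (blast intro: tensor_eq.trans)
next
  case (plus v v' w w')
  then show ?case by (simp add: wedge_presum_simps tensor_eq.plus)
next
  case (zero \<pi>s)
  then show ?case by (simp add: wedge_presum_simps tensor_eq.zero)
next
  case (add_coeff f f' \<pi>s)
  then show ?case
    using tensor_eq.add_coeff[of "\<lambda>x. g x * f x" "\<lambda>x. g x * f' x" "\<sigma>s @ \<pi>s"]
    by (simp add: wedge_presum_def bcontfun_mult_real distrib_left add_mset_commute)
next
  case (add_slot f \<pi>s p q \<rho>s)
  then show ?case
    using tensor_eq.add_slot[of "\<lambda>x. g x * f x" "\<sigma>s @ \<pi>s" p q \<rho>s]
    by (simp add: wedge_presum_def bcontfun_mult_real add_mset_commute)
next
  case (scale f \<pi>s p \<rho>s c)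
  then show ?case
    using tensor_eq.scale[of "\<lambda>x. g x * f x" "\<sigma>s @ \<pi>s" p \<rho>s c]
    by (simp add: wedge_presum_def bcontfun_mult_real mult.left_commute)
next
  case (alternating f \<pi>s p \<rho>s \<tau>s)
  then show ?case
    using tensor_eq.alternating[of "\<lambda>x. g x * f x" "\<sigma>s @ \<pi>s" p \<rho>s \<tau>s]
    by (simp add: wedge_presum_def bcontfun_mult_real)
qed

lemma wedge_presum_cong:
  assumes vv: "tensor_eq v v'" and ww: "tensor_eq w w'"
  shows "tensor_eq (wedge_presum v w) (wedge_presum v' w')"
proof -
  have "tensor_eq (wedge_presum v u) (wedge_presum v' u)" if "is_presum u" for u
    using that
  proof (induction u)
    case empty
    show ?case by (simp add: wedge_presum_simps tensor_eq.refl)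
  next
    case (add x u)
    obtain g \<sigma>s where x: "x = (g, \<sigma>s)" by (cases x)
    show ?case
      using add unfolding x
      by (subst (1 2) wedge_presum_add_mset_right)
        (auto intro!: tensor_eq.plus wedge_presum_cong_left1 vv)
  qed
  moreover have "tensor_eq (wedge_presum u w) (wedge_presum u w')" if "is_presum u" for u
    using that
  proof (induction u)
    case empty
    show ?case by (simp add: wedge_presum_simps tensor_eq.refl)
  next
    case (add x u)
    obtain g \<sigma>s where x: "x = (g, \<sigma>s)" by (cases x)
    show ?case
      using add unfolding x
      by (subst (1 2) wedge_presum_add_mset_left)
        (auto intro!: tensor_eq.plus wedge_presum_cong_right1 ww)
  qed
  ultimately show ?thesis
    using tensor_eq_is_presum[OF vv] tensor_eq_is_presum[OF ww] tensor_eq.trans by blast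
qed

lemma scale_presum_0: "is_presum v \<Longrightarrow> tensor_eq (scale_presum 0 v) {#}"
proof (induction v)
  case empty
  show ?case by (simp add: tensor_eq.refl)
next
  case (add x v)
  obtain g \<sigma>s where x: "x = (g, \<sigma>s)" by (cases x)
  show ?case
    using add tensor_eq.plus[OF tensor_eq.zero[of \<sigma>s], of "scale_presum 0 v" "{#}"]
    by (simp add: x)
qed

lemma scale_presum_add:
  "is_presum v \<Longrightarrow> tensor_eq (scale_presum (a + b) v) (scale_presum a v + scale_presum b v)"
proof (induction v)
  case empty
  show ?case by (simp add: tensor_eq.refl)
next
  case (add x v)
  obtain g \<sigma>s where x: "x = (g, \<sigma>s)" by (cases x)
  have "tensor_eq ({#(\<lambda>x. a * g x + b * g x, \<sigma>s)#} + scale_presum (a + b) v)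
      ({#(\<lambda>x. a * g x, \<sigma>s), (\<lambda>x. b * g x, \<sigma>s)#} + (scale_presum a v + scale_presum b v))"
    using add by (intro tensor_eq.plus tensor_eq.add_coeff) (auto simp: x bcontfun_mult_real)
  then show ?case by (simp add: x distrib_right add_mset_commute)
qed

lemma scale_presum_scale: "scale_presum a (scale_presum b v) = scale_presum (a * b) v"
  by (induction v) (auto simp: mult.assoc)

lemma scale_presum_1: "scale_presum 1 v = v"
  by (induction v) auto

instantiation tensor :: (metric_space) real_vector
begin

lift_definition zero_tensor :: "'a tensor" is "{#}" by (simp add: tensor_eq.refl)

lift_definition plus_tensor :: "'a tensor \<Rightarrow> 'a tensor \<Rightarrow> 'a tensor" is "(+)"
  by (rule tensor_eq.plus)

lift_definition scaleR_tensor :: "real \<Rightarrow> 'a tensor \<Rightarrow> 'a tensor" is scale_presum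
  by (rule scale_presum_cong)

definition uminus_tensor :: "'a tensor \<Rightarrow> 'a tensor" where "uminus_tensor v = (-1) *\<^sub>R v"

definition minus_tensor :: "'a tensor \<Rightarrow> 'a tensor \<Rightarrow> 'a tensor" where "minus_tensor v w = v + - w"

instance
proof
  fix u v w :: "'a tensor" and a b :: real
  show "u + v + w = u + (v + w)"
    by transfer (simp add: tensor_eq.plus add.assoc)
  show "v + w = w + v"
    by transfer (metis add.commute tensor_eq.plus)
  show "0 + v = v"
    by transfer simp
  show "a *\<^sub>R (v + w) = a *\<^sub>R v + a *\<^sub>R w"
    by transfer (simp add: tensor_eq.plus scale_presum_cong)
  show distr: "(a + b) *\<^sub>R v = a *\<^sub>R v + b *\<^sub>R v" for a b and v :: "'a tensor"
    by transfer (simp add: scale_presum_add tensor_eq_refl_iff)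
  show "a *\<^sub>R b *\<^sub>R v = (a * b) *\<^sub>R v"
    by transfer (simp add: scale_presum_scale scale_presum_cong)
  show one: "1 *\<^sub>R v = v" for v :: "'a tensor"
    by transfer (simp add: scale_presum_1)
  have "0 *\<^sub>R v = 0"
    by transfer (simp add: scale_presum_0 tensor_eq_refl_iff)
  then show "- v + v = 0"
    using distr[of "-1" 1 v] by (simp add: uminus_tensor_def one)
  show "v - w = v + - w"
    by (rule minus_tensor_def)
qed

end

lift_definition wedge :: "'a::metric_space tensor \<Rightarrow> 'a tensor \<Rightarrow> 'a tensor" is wedge_presum
  by (rule wedge_presum_cong)

text \<open>\<open>dform f [\<pi>\<^sub>1, \<dots>, \<pi>\<^sub>k]\<close> is the element $f\,d\pi_1 \wedge \dots \wedge d\pi_k$; it is meaningful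
  for bounded continuous \<open>f\<close> and Lipschitz \<open>\<pi>\<^sub>1, \<dots>, \<pi>\<^sub>k\<close> only.\<close>

definition dform :: "('a::metric_space \<Rightarrow> real) \<Rightarrow> ('a \<Rightarrow> real) list \<Rightarrow> 'a tensor" where
  "dform f \<pi>s = abs_tensor {#(f, \<pi>s)#}"

definition forms :: "nat \<Rightarrow> 'a::metric_space tensor set" where
  "forms k = span {dform f \<pi>s | f \<pi>s. f \<in> bcontfun \<and> \<pi>s \<in> LIP_tuples k}"

lemma bilinear_wedge: "bilinear wedge"
proof -
  have s: "wedge_presum (scale_presum c v) w = scale_presum c (wedge_presum v w)"
    "wedge_presum v (scale_presum c w) = scale_presum c (wedge_presum v w)" for c v w
  proof -
    have *: "wedge_presum {#(\<lambda>x. c * f x, \<pi>s)#} w = scale_presum c (wedge_presum {#(f, \<pi>s)#} w)"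
      "wedge_presum {#(f, \<pi>s)#} (scale_presum c w) = scale_presum c (wedge_presum {#(f, \<pi>s)#} w)"
      for f \<pi>s
      by (induction w) (auto simp: wedge_presum_def mult.assoc mult.left_commute)
    show "wedge_presum (scale_presum c v) w = scale_presum c (wedge_presum v w)"
    proof (induction v)
      case (add x v)
      then show ?case
        by (cases x) (simp add: wedge_presum_add_mset_left[of _ "scale_presum c v"]
            wedge_presum_add_mset_left[of _ v] *)
    qed (simp add: wedge_presum_simps)
    show "wedge_presum v (scale_presum c w) = scale_presum c (wedge_presum v w)"
    proof (induction v)
      case (add x v)
      then show ?case
        by (cases x) (simp add: wedge_presum_add_mset_left[of _ v] *)
    qed (simp add: wedge_presum_simps)
  qed
  have "wedge (u + v) w = wedge u w + wedge v w" "wedge w (u + v) = wedge w u + wedge w v"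
    for u v w :: "'a tensor"
    by (transfer, simp add: wedge_presum_simps wedge_presum_cong tensor_eq.plus)+
  moreover have "wedge (c *\<^sub>R v) w = c *\<^sub>R wedge v w" "wedge v (c *\<^sub>R w) = c *\<^sub>R wedge v w"
    for c and v w :: "'a tensor"
    by (transfer, simp add: s wedge_presum_cong scale_presum_cong)+
  ultimately show ?thesis by (auto simp: bilinear_def intro!: linearI)
qed

lemma wedge_dform:
  assumes "f \<in> bcontfun" "set \<pi>s \<subseteq> LIP" "g \<in> bcontfun" "set \<rho>s \<subseteq> LIP"
  shows "wedge (dform f \<pi>s) (dform g \<rho>s) = dform (\<lambda>x. f x * g x) (\<pi>s @ \<rho>s)"
  using assms unfolding dform_def
  by (subst wedge.abs_eq) (auto simp: wedge_presum_simps tensor_eq_refl_iff)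

lemma wedge_forms:
  assumes "v \<in> forms n" "w \<in> forms m"
  shows "wedge v w \<in> forms (n + m)"
  using assms(1) unfolding forms_def
proof (induction rule: span_induct)
  case base
  show ?case
    by (auto simp: subspace_def bilinear_lzero[OF bilinear_wedge] bilinear_ladd[OF bilinear_wedge]
        bilinear_lmul[OF bilinear_wedge] span_zero span_add span_scale)
next
  case (step x)
  then obtain f \<pi>s where x: "x = dform f \<pi>s" and f: "f \<in> bcontfun" and \<pi>s: "\<pi>s \<in> LIP_tuples n"
    by blast
  show ?case
    using assms(2) unfolding forms_def
  proof (induction rule: span_induct)
    case base
    show ?case
      by (auto simp: subspace_def bilinear_rzero[OF bilinear_wedge] bilinear_radd[OF bilinear_wedge]
          bilinear_rmul[OF bilinear_wedge] span_zero span_add span_scale)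
  next
    case (step y)
    then obtain g \<rho>s where y: "y = dform g \<rho>s" and g: "g \<in> bcontfun" and \<rho>s: "\<rho>s \<in> LIP_tuples m"
      by blast
    have "wedge x y = dform (\<lambda>x. f x * g x) (\<pi>s @ \<rho>s)" "\<pi>s @ \<rho>s \<in> LIP_tuples (n + m)"
      using f g \<pi>s \<rho>s unfolding x y by (auto simp: LIP_tuples_def intro!: wedge_dform)
    then show ?case using bcontfun_mult_real[OF f g] by (blast intro: span_base)
  qed
qed


section \<open>The seminorm and the spaces of metric forms\<close>

text \<open>\<open>acts_as k T L\<close>: the linear map \<open>L\<close> is, in degree \<open>k\<close>, the current \<open>T\<close> after its extension
  to bounded continuous coefficients that still satisfies the mass inequality. In degree \<open>k\<close>
  such an \<open>L\<close> exists and is unique; the values of \<open>L\<close> in other degrees are irrelevant.\<close>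

definition acts_as ::
    "nat \<Rightarrow> (('a::metric_space \<Rightarrow> real) \<Rightarrow> ('a \<Rightarrow> real) list \<Rightarrow> real) \<Rightarrow> ('a tensor \<Rightarrow> real) \<Rightarrow> bool" where
  "acts_as k T L \<longleftrightarrow>
    linear L \<and>
    (\<forall>f\<in>LIPb. \<forall>\<pi>s\<in>LIP_tuples k. L (dform f \<pi>s) = T f \<pi>s) \<and>
    (\<forall>f\<in>bcontfun. \<forall>\<pi>s\<in>LIP_tuples k.
       \<bar>L (dform f \<pi>s)\<bar> \<le> (\<Prod>j<k. Lip (\<pi>s ! j)) * (\<integral>x. \<bar>f x\<bar> \<partial>AK_mass k T))"

text \<open>The set below contains 0 and is bounded above, so the supremum in the reals is a genuine
  one.\<close>

definition seminorm :: "nat \<Rightarrow> 'a::metric_space tensor \<Rightarrow> real" where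
  "seminorm k v =
     Sup {L v | T L. current k T \<and> measure (AK_mass k T) UNIV \<le> 1 \<and> acts_as k T L}"

text \<open>The elements of \<open>metric_forms k\<close> are equivalence classes, so that \<open>v \<in> V\<close> for
  \<open>V \<in> metric_forms k\<close> says that \<open>v\<close> represents \<open>V\<close>.\<close>

definition metric_forms :: "nat \<Rightarrow> 'a::metric_space tensor set set" where
  "metric_forms k = forms k // {(v, w). v \<in> forms k \<and> w \<in> forms k \<and> seminorm k (v - w) = 0}"

end

theory Submission
  imports Defs
begin

text \<open>
  Let \<open>T\<close> be an $(n+m)$-current. For fixed \<open>f\<close> and $\pi_1,\dots,\pi_n$ the map
  $(g,\rho) \mapsto T(fg, \pi, \rho)$ is an \<open>m\<close>-current whose mass is at most
  $\prod_j \mathrm{Lip}(\pi_j)\,|f|\,\|T\|$. Evaluating it at \<open>w\<close> gives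
  $|T(f\,d\pi \wedge w)| \le \|w\| \prod_j \mathrm{Lip}(\pi_j) \int |f|\,d\|T\|$, so the contraction of
  \<open>T\<close> with \<open>w\<close> is an \<open>n\<close>-current of mass at most $\|w\|\,\|T\|$; evaluate it at \<open>v\<close>.
  Comparing \<open>AK_mass\<close> with these upper bounds requires that the minimal measure exists: two bounds
  can be glued along any Borel set, by Lipschitz cutoffs and inner regularity.
\<close>

section \<open>Lipschitz functions\<close>

text \<open>The seminorm is a supremum over currents, so splitting \<open>v\<close> or
  \<open>w\<close> into generators and adding up would lose the sharp constant. Sharpness is kept by
  dividing the tasks: the quantitative bound for contracting with \<open>w\<close> is read off from
  \<open>w\<close> as a whole, one pair (\<open>f\<close>, \<open>\<pi>s\<close>) at a time, whereas
  continuity and locality are stable under linear combinations and may be checked on the generators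
  of \<open>w\<close>. A second obstacle is the class of coefficients: the axioms of a current speak
  of bounded Lipschitz ones, but forms have bounded continuous ones. Hence the linear map
  \<open>L\<close> takes the place of \<open>T\<close>, and the axioms are carried over to it by
  approximation in L1. A third one is the minimal measure: an infimum of arbitrary bounds is awkward
  to form, so total mass is first minimised over densities with respect to a single bound, where
  minima are pointwise, and every other bound is then compared with the minimiser by Hahn and
  Radon-Nikodym. Completeness and separability enter through inner regularity.\<close>

lemma Lip_nonneg:
  assumes "f \<in> LIP"
  shows "0 \<le> Lip f"
  unfolding Lip_def
  by (rule cInf_greatest) (use assms in \<open>auto simp: LIP_def intro: lipschitz_on_nonneg\<close>)

lemma Lip_le:
  assumes "L-lipschitz_on UNIV f"
  shows "Lip f \<le> L"
  unfolding Lip_def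
  by (rule cInf_lower) (use assms in \<open>auto intro!: bdd_belowI[of _ 0] intro: lipschitz_on_nonneg\<close>)

lemma LIP_continuous: "f \<in> LIP \<Longrightarrow> continuous_on UNIV f"
  by (auto simp: LIP_def intro: lipschitz_on_continuous_on)

lemma LIPb_bcontfun: "f \<in> LIPb \<Longrightarrow> f \<in> bcontfun"
  by (auto simp: LIPb_def bcontfun_def LIP_continuous)

lemma bcontfun_boundE:
  fixes f :: "'a::metric_space \<Rightarrow> real"
  assumes "f \<in> bcontfun"
  obtains B where "0 \<le> B" "\<And>x. \<bar>f x\<bar> \<le> B"
proof -
  obtain B where B: "\<And>x. \<bar>f x\<bar> \<le> B" using assms by (auto simp: bcontfun_def bounded_iff)
  moreover have "0 \<le> B" using order_trans[OF abs_ge_zero B] by auto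
  ultimately show ?thesis using that by auto
qed

lemma bcontfun_measurable [measurable_dest]:
  fixes f :: "'a::metric_space \<Rightarrow> real"
  shows "f \<in> bcontfun \<Longrightarrow> f \<in> borel_measurable borel"
  by (auto simp: bcontfun_def intro: borel_measurable_continuous_onI)

lemma bcontfun_integrable:
  fixes f :: "'a::metric_space \<Rightarrow> real"
  assumes "f \<in> bcontfun" "finite_measure \<mu>" "sets \<mu> = sets borel"
  shows "integrable \<mu> f"
proof -
  interpret finite_measure \<mu> by fact
  obtain B where "\<And>x. \<bar>f x\<bar> \<le> B" using bcontfun_boundE[OF assms(1)] by metis
  moreover have "f \<in> borel_measurable \<mu>"
    using bcontfun_measurable[OF assms(1)] assms(3) by (simp cong: measurable_cong_sets)
  ultimately show ?thesis by (intro integrable_const_bound[of _ B]) auto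
qed

lemma bcontfun_minus_real:
  fixes f g :: "'a::metric_space \<Rightarrow> real"
  shows "f \<in> bcontfun \<Longrightarrow> g \<in> bcontfun \<Longrightarrow> (\<lambda>x. f x - g x) \<in> bcontfun"
  by (auto simp: bcontfun_def intro!: continuous_intros bounded_minus_comp)

lemma bcontfun_abs_real:
  fixes f :: "'a::metric_space \<Rightarrow> real"
  shows "f \<in> bcontfun \<Longrightarrow> (\<lambda>x. \<bar>f x\<bar>) \<in> bcontfun"
  by (auto simp: bcontfun_def bounded_iff intro!: continuous_intros)

section \<open>Bounded Lipschitz functions: products, differences, approximation of continuous
  functions\<close>

lemma LIPbI:
  assumes "L-lipschitz_on UNIV f" "\<And>x. \<bar>f x\<bar> \<le> B"
  shows "f \<in> LIPb"
  using assms by (auto simp: LIPb_def LIP_def bounded_iff)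

lemma LIPbE:
  assumes "f \<in> LIPb"
  obtains L B where "L-lipschitz_on UNIV f" "0 \<le> B" "\<And>x. \<bar>f x\<bar> \<le> B"
proof -
  obtain L where "L-lipschitz_on UNIV f" using assms by (auto simp: LIPb_def LIP_def)
  moreover obtain B where "0 \<le> B" "\<And>x. \<bar>f x\<bar> \<le> B"
    using bcontfun_boundE[OF LIPb_bcontfun[OF assms]] by metis
  ultimately show ?thesis by (rule that)
qed

lemma LIPb_mult:
  assumes "f \<in> LIPb" "g \<in> LIPb"
  shows "(\<lambda>x. f x * g x) \<in> LIPb"
proof -
  obtain L B where f: "L-lipschitz_on UNIV f" "0 \<le> B" "\<And>x. \<bar>f x\<bar> \<le> B" using LIPbE[OF assms(1)] by metis
  obtain M C where g: "M-lipschitz_on UNIV g" "0 \<le> C" "\<And>x. \<bar>g x\<bar> \<le> C" using LIPbE[OF assms(2)] by metis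
  note nn = lipschitz_on_nonneg[OF f(1)] lipschitz_on_nonneg[OF g(1)]
  have d: "\<bar>f x - f y\<bar> \<le> L * dist x y" "\<bar>g x - g y\<bar> \<le> M * dist x y" for x y
    using lipschitz_onD[OF f(1)] lipschitz_onD[OF g(1)] by (auto simp: dist_real_def)
  have "(L * C + B * M)-lipschitz_on UNIV (\<lambda>x. f x * g x)"
  proof (rule lipschitz_onI)
    fix x y
    have "\<bar>f x * g x - f y * g y\<bar> = \<bar>(f x - f y) * g x + f y * (g x - g y)\<bar>"
      by (simp add: algebra_simps)
    also have "\<dots> \<le> \<bar>f x - f y\<bar> * \<bar>g x\<bar> + \<bar>f y\<bar> * \<bar>g x - g y\<bar>"
      by (metis abs_mult abs_triangle_ineq)
    also have "\<dots> \<le> (L * dist x y) * C + B * (M * dist x y)"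
      by (intro add_mono mult_mono d f g) (auto simp: nn f g)
    finally show "dist (f x * g x) (f y * g y) \<le> (L * C + B * M) * dist x y"
      by (simp add: dist_real_def algebra_simps)
  qed (use nn f g in auto)
  moreover have "\<bar>f x * g x\<bar> \<le> B * C" for x
    unfolding abs_mult by (intro mult_mono f g) (use f in auto)
  ultimately show ?thesis by (rule LIPbI)
qed

lemma LIPb_const [simp]: "(\<lambda>x. c) \<in> LIPb"
  by (rule LIPbI[of 0 _ "\<bar>c\<bar>"]) (auto simp: lipschitz_on_def)

lemma LIPb_minus:
  assumes "f \<in> LIPb" "g \<in> LIPb"
  shows "(\<lambda>x. f x - g x) \<in> LIPb"
proof -
  obtain L B where f: "L-lipschitz_on UNIV f" "0 \<le> B" "\<And>x. \<bar>f x\<bar> \<le> B" using LIPbE[OF assms(1)] by metis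
  obtain M C where g: "M-lipschitz_on UNIV g" "0 \<le> C" "\<And>x. \<bar>g x\<bar> \<le> C" using LIPbE[OF assms(2)] by metis
  show ?thesis
  proof (rule LIPbI)
    show "(L + M)-lipschitz_on UNIV (\<lambda>x. f x - g x)"
      using f g by (intro lipschitz_intros)
    show "\<bar>f x - g x\<bar> \<le> B + C" for x using f(3)[of x] g(3)[of x] by linarith
  qed
qed

text \<open>The approximants are the Lipschitz regularisations
  $F_i(x) = \inf_y\, (f(y) + i\,d(x,y))$.\<close>

lemma bcontfun_approx_LIPb:
  fixes f :: "'a::metric_space \<Rightarrow> real"
  assumes "f \<in> bcontfun"
  obtains F B where "\<And>i::nat. F i \<in> LIPb" "\<And>i x. \<bar>F i x\<bar> \<le> B" "\<And>x. (\<lambda>i. F i x) \<longlonglongrightarrow> f x"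
proof -
  obtain B where B: "0 \<le> B" "\<And>x. \<bar>f x\<bar> \<le> B" using bcontfun_boundE[OF assms] by metis
  define F where "F i x = (INF y. f y + real i * dist x y)" for i x
  have lowb: "- B \<le> f y + real i * dist x y" for i x y
    using B(2)[of y] by (intro add_increasing2) (simp_all add: abs_le_iff)
  have bdd: "bdd_below (range (\<lambda>y. f y + real i * dist x y))" for i x
    using lowb by (auto intro!: bdd_belowI[of _ "- B"])
  have low: "- B \<le> F i x" for i x
    unfolding F_def by (rule cINF_greatest) (use lowb in auto)
  have le: "F i x \<le> f y + real i * dist x y" for i x y
    unfolding F_def by (rule cINF_lower[OF bdd]) simp
  have up: "F i x \<le> f x" for i x using le[of i x x] by simp
  have bound: "\<bar>F i x\<bar> \<le> B" for i x
    using low[of i x] up[of i x] B(2)[of x] by (auto simp: abs_le_iff)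
  have step: "F i x \<le> F i y + real i * dist x y" for i x y
  proof -
    have "F i x - real i * dist x y \<le> F i y"
      unfolding F_def[of i y]
    proof (rule cINF_greatest)
      fix z
      have "real i * dist x z \<le> real i * dist x y + real i * dist y z"
        using mult_left_mono[OF dist_triangle[of x z y], of "real i"] by (simp add: distrib_left)
      then show "F i x - real i * dist x y \<le> f z + real i * dist y z"
        using le[of i x z] by linarith
    qed simp
    then show ?thesis by simp
  qed
  have "(real i)-lipschitz_on UNIV (F i)" for i
  proof (rule lipschitz_onI)
    show "dist (F i x) (F i y) \<le> real i * dist x y" for x y
      using step[of i x y] step[of i y x] by (auto simp: dist_real_def abs_le_iff dist_commute)
  qed simp
  then have "F i \<in> LIPb" for i using bound by (rule LIPbI)
  moreover have "(\<lambda>i. F i x) \<longlonglongrightarrow> f x" for x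
  proof (rule LIMSEQ_I)
    fix e :: real assume e: "0 < e"
    have "isCont f x" using assms by (auto simp: bcontfun_def continuous_on_eq_continuous_at)
    then obtain d where d: "0 < d" "\<And>y. dist y x < d \<Longrightarrow> dist (f y) (f x) < e / 2"
      using e unfolding continuous_at_eps_delta by (metis half_gt_zero)
    \<comment> \<open>Points \<open>y\<close> at distance at least \<open>d\<close> from
      \<open>x\<close> cannot lower the infimum below \<open>f x\<close> once the penalty reaches
      2B, the largest possible oscillation of \<open>f\<close>; nearby points are handled by
      continuity.\<close>
    obtain N :: nat where N: "2 * B / d < real N" using reals_Archimedean2 by blast
    have "norm (F i x - f x) < e" if "N \<le> i" for i
    proof -
      have "f x - e / 2 \<le> F i x"
        unfolding F_def
      proof (rule cINF_greatest)
        fix y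
        show "f x - e / 2 \<le> f y + real i * dist x y"
        proof (cases "dist y x < d")
          case True
          then have "f x - e / 2 \<le> f y" using d(2)[OF True] unfolding dist_real_def by linarith
          then show ?thesis by (simp add: add_increasing2)
        next
          case False
          have "2 * B \<le> real N * d" using N d(1) by (simp add: field_simps)
          also have "\<dots> \<le> real i * dist x y"
            using that False d(1) by (intro mult_mono) (auto simp: dist_commute)
          finally have "2 * B \<le> real i * dist x y" .
          then show ?thesis using B(2)[of x] B(2)[of y] e by (auto simp: abs_le_iff)
        qed
      qed simp
      then show ?thesis using up[of i x] e by simp
    qed
    then show "\<exists>N. \<forall>i\<ge>N. norm (F i x - f x) < e" by blast
  qed
  ultimately show ?thesis using that bound by blast
qed

text \<open>Dominated convergence with the constant \<open>B\<close>, integrable because the measure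
  is finite. The limit is only assumed measurable, so that indicators of closed sets may occur in
  it.\<close>

lemma integral_bcontfun_tendsto:
  fixes f :: "'a::metric_space \<Rightarrow> real"
  assumes \<mu>: "finite_measure \<mu>" "sets \<mu> = sets borel"
    and f: "f \<in> borel_measurable borel" and F: "\<And>i. F i \<in> borel_measurable borel"
    and B: "\<And>i x. \<bar>F i x\<bar> \<le> B" and lim: "\<And>x. (\<lambda>i::nat. F i x) \<longlonglongrightarrow> f x"
  shows "(\<lambda>i. \<integral>x. F i x \<partial>\<mu>) \<longlonglongrightarrow> (\<integral>x. f x \<partial>\<mu>)"
proof (rule integral_dominated_convergence[where w = "\<lambda>_. B"])
  interpret finite_measure \<mu> by fact
  show "integrable \<mu> (\<lambda>_. B)" by simp
qed (use f F B lim \<mu>(2) in \<open>auto cong: measurable_cong_sets\<close>)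

section \<open>Existence of the mass measure\<close>

definition prod_Lip :: "nat \<Rightarrow> ('a::metric_space \<Rightarrow> real) list \<Rightarrow> real" where
  "prod_Lip k \<pi>s = (\<Prod>j<k. Lip (\<pi>s ! j))"

lemma prod_Lip_nonneg: "\<pi>s \<in> LIP_tuples k \<Longrightarrow> 0 \<le> prod_Lip k \<pi>s"
  unfolding prod_Lip_def LIP_tuples_def by (intro prod_nonneg) (auto intro!: Lip_nonneg)

lemma mass_bound_prod_Lip:
  "mass_bound k T \<mu> \<longleftrightarrow> finite_measure \<mu> \<and> sets \<mu> = sets borel \<and>
    (\<forall>f\<in>LIPb. \<forall>\<pi>s\<in>LIP_tuples k. \<bar>T f \<pi>s\<bar> \<le> prod_Lip k \<pi>s * (\<integral>x. \<bar>f x\<bar> \<partial>\<mu>))"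
  by (simp add: mass_bound_def prod_Lip_def)

section \<open>Gluing two mass bounds along a Borel set\<close>

lemma multilinear_add_coeff:
  assumes "multilinear k T" "f \<in> LIPb" "g \<in> LIPb" "\<pi>s \<in> LIP_tuples k"
  shows "T (\<lambda>x. f x + g x) \<pi>s = T f \<pi>s + T g \<pi>s"
proof -
  have "T (\<lambda>x. 1 * f x + 1 * g x) \<pi>s = 1 * T f \<pi>s + 1 * T g \<pi>s"
    using assms unfolding multilinear_def by blast
  then show ?thesis by simp
qed

text \<open>Write f as a cutoff part plus a remainder, estimate the first with \<open>\<mu>\<close>
  and the second with \<open>\<nu>\<close>, and let the cutoffs tend to the indicator of
  \<open>K\<close>. Closedness makes them converge to 0 at every point outside
  \<open>K\<close>.\<close>

lemma mass_bound_split_closed: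
  fixes T :: "('a::metric_space \<Rightarrow> real) \<Rightarrow> ('a \<Rightarrow> real) list \<Rightarrow> real"
  assumes T: "multilinear k T" and \<mu>: "mass_bound k T \<mu>" and \<nu>: "mass_bound k T \<nu>"
    and K: "closed K" and f: "f \<in> LIPb" and \<pi>s: "\<pi>s \<in> LIP_tuples k"
  shows "\<bar>T f \<pi>s\<bar> \<le> prod_Lip k \<pi>s *
    ((\<integral>x. indicator K x * \<bar>f x\<bar> \<partial>\<mu>) + (\<integral>x. indicator (- K) x * \<bar>f x\<bar> \<partial>\<nu>))"
proof (cases "K = {}")
  \<comment> \<open>The distance to the empty set is 0 by convention, so the cutoffs below would all
    be constantly 1. Here the claim is just the bound by \<open>\<nu>\<close>.\<close>
  case True
  then show ?thesis using \<nu> f \<pi>s by (simp add: mass_bound_prod_Lip)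
next
  case False
  \<comment> \<open>The Lipschitz constants of the cutoffs blow up, which is harmless: the mass
    inequality sees the coefficient only through its L1 norm.\<close>
  define \<phi> where "\<phi> i x = max 0 (1 - real i * infdist x K)" for i x
  have \<phi>01: "0 \<le> \<phi> i x" "\<phi> i x \<le> 1" for i x
    by (auto simp: \<phi>_def infdist_nonneg)
  have "(real i)-lipschitz_on UNIV (\<phi> i)" for i
  proof (rule lipschitz_onI)
    fix x y
    have "\<bar>real i * infdist x K - real i * infdist y K\<bar> = real i * \<bar>infdist x K - infdist y K\<bar>"
      by (simp add: abs_mult flip: right_diff_distrib)
    also have "\<dots> \<le> real i * dist x y"
      by (intro mult_left_mono infdist_triangle_abs) simp
    finally show "dist (\<phi> i x) (\<phi> i y) \<le> real i * dist x y"
      by (auto simp: \<phi>_def dist_real_def)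
  qed simp
  then have \<phi>: "\<phi> i \<in> LIPb" for i
    using \<phi>01 by (intro LIPbI[where B = 1]) auto
  have lim\<phi>: "(\<lambda>i. \<phi> i x) \<longlonglongrightarrow> indicator K x" for x
  proof (cases "x \<in> K")
    case True
    then show ?thesis by (simp add: \<phi>_def)
  next
    case x: False
    then have pos: "0 < infdist x K"
      using K False by (simp add: infdist_pos_not_in_closed)
    obtain N :: nat where N: "1 / infdist x K < real N" using reals_Archimedean2 by blast
    have "\<phi> i x = 0" if "N \<le> i" for i
    proof -
      have "1 \<le> real N * infdist x K" using N pos by (simp add: field_simps)
      also have "\<dots> \<le> real i * infdist x K" using that pos by (intro mult_right_mono) auto
      finally show ?thesis by (simp add: \<phi>_def)
    qed
    then have "\<forall>\<^sub>F i in sequentially. \<phi> i x = 0" by (auto simp: eventually_sequentially)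
    then show ?thesis using x by (simp add: tendsto_eventually)
  qed
  have \<phi>': "(\<lambda>x. 1 - \<phi> i x) \<in> LIPb" for i by (intro LIPb_minus \<phi> LIPb_const)
  obtain B where B: "0 \<le> B" "\<And>x. \<bar>f x\<bar> \<le> B" using bcontfun_boundE[OF LIPb_bcontfun[OF f]] by metis
  have [measurable]: "f \<in> borel_measurable borel" "\<phi> i \<in> borel_measurable borel" for i
    using f \<phi> by (auto intro: bcontfun_measurable LIPb_bcontfun)
  have [measurable]: "K \<in> sets borel" using K by simp
  have le: "\<bar>T f \<pi>s\<bar> \<le> prod_Lip k \<pi>s *
      ((\<integral>x. \<phi> i x * \<bar>f x\<bar> \<partial>\<mu>) + (\<integral>x. (1 - \<phi> i x) * \<bar>f x\<bar> \<partial>\<nu>))" for i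
  proof -
    have "T f \<pi>s = T (\<lambda>x. \<phi> i x * f x + (1 - \<phi> i x) * f x) \<pi>s" by (simp add: algebra_simps)
    also have "\<dots> = T (\<lambda>x. \<phi> i x * f x) \<pi>s + T (\<lambda>x. (1 - \<phi> i x) * f x) \<pi>s"
      by (intro multilinear_add_coeff[OF T] LIPb_mult \<phi> \<phi>' f \<pi>s)
    finally have "\<bar>T f \<pi>s\<bar> \<le> \<bar>T (\<lambda>x. \<phi> i x * f x) \<pi>s\<bar> + \<bar>T (\<lambda>x. (1 - \<phi> i x) * f x) \<pi>s\<bar>"
      by linarith
    also have "\<dots> \<le> prod_Lip k \<pi>s * (\<integral>x. \<bar>\<phi> i x * f x\<bar> \<partial>\<mu>) +
        prod_Lip k \<pi>s * (\<integral>x. \<bar>(1 - \<phi> i x) * f x\<bar> \<partial>\<nu>)"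
      using \<mu> \<nu> \<pi>s LIPb_mult[OF \<phi> f] LIPb_mult[OF \<phi>' f]
      by (intro add_mono) (auto simp: mass_bound_prod_Lip)
    finally show ?thesis using \<phi>01 by (simp add: abs_mult distrib_left)
  qed
  have l1: "(\<lambda>i. \<integral>x. \<phi> i x * \<bar>f x\<bar> \<partial>\<mu>) \<longlonglongrightarrow> (\<integral>x. indicator K x * \<bar>f x\<bar> \<partial>\<mu>)"
  proof (rule integral_bcontfun_tendsto[where B = B])
    show "\<bar>\<phi> i x * \<bar>f x\<bar>\<bar> \<le> B" for i x
      using mult_mono[OF \<phi>01(2)[of i x] B(2)[of x]] \<phi>01[of i x] by (simp add: abs_mult)
    show "(\<lambda>i. \<phi> i x * \<bar>f x\<bar>) \<longlonglongrightarrow> indicator K x * \<bar>f x\<bar>" for x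
      by (intro tendsto_intros lim\<phi>)
  qed (use \<mu> in \<open>auto simp: mass_bound_def\<close>)
  have l2: "(\<lambda>i. \<integral>x. (1 - \<phi> i x) * \<bar>f x\<bar> \<partial>\<nu>) \<longlonglongrightarrow> (\<integral>x. indicator (- K) x * \<bar>f x\<bar> \<partial>\<nu>)"
  proof (rule integral_bcontfun_tendsto[where B = B])
    show "\<bar>(1 - \<phi> i x) * \<bar>f x\<bar>\<bar> \<le> B" for i x
      using mult_mono[of "1 - \<phi> i x" 1 "\<bar>f x\<bar>" B] B(2)[of x] \<phi>01[of i x] by (simp add: abs_mult)
    have "indicator (- K) x = (1 - indicator K x :: real)" for x by (simp split: split_indicator)
    then show "(\<lambda>i. (1 - \<phi> i x) * \<bar>f x\<bar>) \<longlonglongrightarrow> indicator (- K) x * \<bar>f x\<bar>" for x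
      by (auto intro!: tendsto_intros lim\<phi>)
  qed (use \<nu> in \<open>auto simp: mass_bound_def\<close>)
  show ?thesis
    by (rule LIMSEQ_le_const[OF tendsto_mult[OF tendsto_const tendsto_add[OF l1 l2]]]) (use le in auto)
qed

lemma integrable_mult_bounded:
  fixes h g :: "'a \<Rightarrow> real"
  assumes "integrable M h" "g \<in> borel_measurable M" "\<And>x. \<bar>g x\<bar> \<le> B"
  shows "integrable M (\<lambda>x. h x * g x)"
proof (rule Bochner_Integration.integrable_bound)
  show "integrable M (\<lambda>x. B * h x)" using assms by simp
  have "\<bar>h x\<bar> * \<bar>g x\<bar> \<le> \<bar>h x\<bar> * \<bar>B\<bar>" for x
    using assms(3)[of x] by (intro mult_left_mono) auto
  then show "AE x in M. norm (h x * g x) \<le> norm (B * h x)" by (simp add: abs_mult mult.commute)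
qed (use assms in measurable)

text \<open>Approximate \<open>A\<close> from inside by a compact set and use the closed case.
  Regularity is needed for \<open>\<nu>\<close> alone: shrinking \<open>A\<close> only decreases the
  integral against \<open>\<mu>\<close>, while the one against \<open>\<nu>\<close> grows by at most
  \<open>B\<close> times the measure of the difference.\<close>

lemma mass_bound_split:
  fixes T :: "('a::polish_space \<Rightarrow> real) \<Rightarrow> ('a \<Rightarrow> real) list \<Rightarrow> real"
  assumes T: "multilinear k T" and \<mu>: "mass_bound k T \<mu>" and \<nu>: "mass_bound k T \<nu>"
    and A: "A \<in> sets borel" and f: "f \<in> LIPb" and \<pi>s: "\<pi>s \<in> LIP_tuples k"
  shows "\<bar>T f \<pi>s\<bar> \<le> prod_Lip k \<pi>s *
    ((\<integral>x. indicator A x * \<bar>f x\<bar> \<partial>\<mu>) + (\<integral>x. indicator (- A) x * \<bar>f x\<bar> \<partial>\<nu>))"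
proof -
  have s\<mu>: "finite_measure \<mu>" "sets \<mu> = sets borel" and s\<nu>: "finite_measure \<nu>" "sets \<nu> = sets borel"
    using \<mu> \<nu> by (auto simp: mass_bound_def)
  interpret \<nu>: finite_measure \<nu> by fact
  obtain B where B: "0 \<le> B" "\<And>x. \<bar>f x\<bar> \<le> B" using bcontfun_boundE[OF LIPb_bcontfun[OF f]] by metis
  have [measurable]: "A \<in> sets borel" "f \<in> borel_measurable borel"
    using A f by (auto intro: bcontfun_measurable LIPb_bcontfun)
  have int: "integrable M (\<lambda>x. indicator E x * \<bar>f x\<bar>)" "integrable M (indicator E :: 'a \<Rightarrow> real)"
    if M: "finite_measure M" "sets M = sets borel" and E: "E \<in> sets borel" for M :: "'a measure" and E
  proof -
    interpret finite_measure M by fact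
    note [measurable_cong] = M(2)
    show 1: "integrable M (indicator E :: 'a \<Rightarrow> real)"
      using E by (intro integrable_const_bound[of _ 1]) (auto split: split_indicator)
    show "integrable M (\<lambda>x. indicator E x * \<bar>f x\<bar>)"
      by (rule integrable_mult_bounded[where B = B]) (use B 1 in auto)
  qed
  define I where "I = (\<integral>x. indicator A x * \<bar>f x\<bar> \<partial>\<mu>) + (\<integral>x. indicator (- A) x * \<bar>f x\<bar> \<partial>\<nu>)"
  have "\<bar>T f \<pi>s\<bar> \<le> prod_Lip k \<pi>s * (I + B * e)" if e: "0 < e" for e
  proof -
    have "\<exists>K\<in>{K. K \<subseteq> A \<and> compact K}. emeasure \<nu> A < emeasure \<nu> K + ennreal e"
    proof (rule SUP_approx_ennreal)
      show "emeasure \<nu> A = (SUP K\<in>{K. K \<subseteq> A \<and> compact K}. emeasure \<nu> K)"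
        by (rule inner_regular) (use s\<nu> A in auto)
    qed (use e in auto)
    then obtain K where K: "K \<subseteq> A" "compact K" "emeasure \<nu> A < emeasure \<nu> K + ennreal e" by blast
    have "closed K" using K(2) by (rule compact_imp_closed)
    then have [measurable]: "K \<in> sets borel" by simp
    have "measure \<nu> A \<le> measure \<nu> K + e"
      using K(3) e by (simp add: \<nu>.emeasure_eq_measure ennreal_less_iff flip: ennreal_plus)
    then have AK: "measure \<nu> (A - K) \<le> e"
      using K(1) s\<nu> by (simp add: \<nu>.finite_measure_Diff)
    have 1: "(\<integral>x. indicator K x * \<bar>f x\<bar> \<partial>\<mu>) \<le> (\<integral>x. indicator A x * \<bar>f x\<bar> \<partial>\<mu>)"
      using K(1) by (intro integral_mono int s\<mu>) (auto split: split_indicator)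
    have "(\<integral>x. indicator (- K) x * \<bar>f x\<bar> \<partial>\<nu>)
        \<le> (\<integral>x. indicator (- A) x * \<bar>f x\<bar> + B * indicator (A - K) x \<partial>\<nu>)"
      using K(1) B by (intro integral_mono int s\<nu> Bochner_Integration.integrable_add integrable_mult_right)
        (auto split: split_indicator)
    also have "\<dots> = (\<integral>x. indicator (- A) x * \<bar>f x\<bar> \<partial>\<nu>) + B * measure \<nu> (A - K)"
      using s\<nu>(2)
      by (subst Bochner_Integration.integral_add[OF int(1)[OF s\<nu>] integrable_mult_right[OF int(2)[OF s\<nu>]]])
        simp_all
    also have "\<dots> \<le> (\<integral>x. indicator (- A) x * \<bar>f x\<bar> \<partial>\<nu>) + B * e"
      by (intro add_left_mono mult_left_mono AK B)
    finally have "prod_Lip k \<pi>s * ((\<integral>x. indicator K x * \<bar>f x\<bar> \<partial>\<mu>) +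
        (\<integral>x. indicator (- K) x * \<bar>f x\<bar> \<partial>\<nu>)) \<le> prod_Lip k \<pi>s * (I + B * e)"
      using 1 by (intro mult_left_mono prod_Lip_nonneg \<pi>s) (auto simp: I_def)
    with mass_bound_split_closed[OF T \<mu> \<nu> \<open>closed K\<close> f \<pi>s] show ?thesis by linarith
  qed
  then have le: "\<bar>T f \<pi>s\<bar> \<le> prod_Lip k \<pi>s * (I + B * inverse (real (Suc i)))" for i by simp
  have "(\<lambda>i. prod_Lip k \<pi>s * (I + B * inverse (real (Suc i)))) \<longlonglongrightarrow> prod_Lip k \<pi>s * (I + B * 0)"
    by (intro tendsto_intros LIMSEQ_inverse_real_of_nat)
  then have "\<bar>T f \<pi>s\<bar> \<le> prod_Lip k \<pi>s * (I + B * 0)"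
    by (rule LIMSEQ_le_const) (use le in auto)
  then show ?thesis by (simp add: I_def)
qed

text \<open>With the reference measure fixed, being a bound becomes an inequality linear in the
  density \<open>h\<close>, a form suited to minima and monotone limits.\<close>

lemma mass_bound_density:
  fixes T :: "('a::metric_space \<Rightarrow> real) \<Rightarrow> ('a \<Rightarrow> real) list \<Rightarrow> real"
  assumes \<mu>: "sets \<mu> = sets borel"
    and h: "h \<in> borel_measurable borel" "\<And>x. 0 \<le> h x" "integrable \<mu> h"
  shows "mass_bound k T (density \<mu> h) \<longleftrightarrow>
    (\<forall>f\<in>LIPb. \<forall>\<pi>s\<in>LIP_tuples k. \<bar>T f \<pi>s\<bar> \<le> prod_Lip k \<pi>s * (\<integral>x. h x * \<bar>f x\<bar> \<partial>\<mu>))"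
proof -
  note [measurable_cong] = \<mu>
  note [measurable] = h(1)
  have "emeasure (density \<mu> h) (space \<mu>) = (\<integral>\<^sup>+x. h x \<partial>\<mu>)"
    by (subst emeasure_density) (simp_all cong: nn_integral_cong)
  also have "\<dots> < \<infinity>"
    using h(3) by (subst nn_integral_eq_integral) (simp_all add: h(2))
  finally have "finite_measure (density \<mu> h)"
    by (intro finite_measureI) simp
  moreover have "(\<integral>x. \<bar>f x\<bar> \<partial>density \<mu> h) = (\<integral>x. h x * \<bar>f x\<bar> \<partial>\<mu>)" if "f \<in> LIPb" for f
  proof -
    have [measurable]: "f \<in> borel_measurable borel"
      using that by (intro bcontfun_measurable LIPb_bcontfun)
    show ?thesis by (rule integral_real_density) (simp_all add: h(2))
  qed
  ultimately show ?thesis using \<mu> by (simp add: mass_bound_prod_Lip)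
qed

text \<open>Among the measures $h\mu_0$ that bound \<open>T\<close> one of least total mass exists, because these
  densities are closed under minima and decreasing limits.\<close>

lemma mass_bound_least_density:
  fixes T :: "('a::polish_space \<Rightarrow> real) \<Rightarrow> ('a \<Rightarrow> real) list \<Rightarrow> real"
  assumes T: "multilinear k T" and \<mu>0: "mass_bound k T \<mu>0"
  obtains g where "g \<in> borel_measurable borel" "\<And>x. 0 \<le> g x" "integrable \<mu>0 g"
    "mass_bound k T (density \<mu>0 g)"
    "\<And>h. h \<in> borel_measurable borel \<Longrightarrow> (\<And>x. 0 \<le> h x) \<Longrightarrow> integrable \<mu>0 h \<Longrightarrow>
       mass_bound k T (density \<mu>0 h) \<Longrightarrow> (\<integral>x. g x \<partial>\<mu>0) \<le> (\<integral>x. h x \<partial>\<mu>0)"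
proof -
  have s\<mu>: "finite_measure \<mu>0" "sets \<mu>0 = sets borel" using \<mu>0 by (auto simp: mass_bound_def)
  interpret finite_measure \<mu>0 by fact
  note [measurable_cong] = s\<mu>(2)
  define H where "H = {h. h \<in> borel_measurable borel \<and> (\<forall>x. 0 \<le> h x) \<and> integrable \<mu>0 h \<and>
    mass_bound k T (density \<mu>0 h)}"
  have HD: "h \<in> borel_measurable borel" "0 \<le> h x" "integrable \<mu>0 h" "mass_bound k T (density \<mu>0 h)"
    if "h \<in> H" for h x using that by (auto simp: H_def)
  have Hbound: "\<bar>T f \<pi>s\<bar> \<le> prod_Lip k \<pi>s * (\<integral>x. h x * \<bar>f x\<bar> \<partial>\<mu>0)"
    if "h \<in> H" "f \<in> LIPb" "\<pi>s \<in> LIP_tuples k" for h and f :: "'a \<Rightarrow> real" and \<pi>s :: "('a \<Rightarrow> real) list"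
    using HD[OF that(1)] that by (subst (asm) mass_bound_density) (auto simp: s\<mu>)
  have HI: "h \<in> H" if "h \<in> borel_measurable borel" "\<And>x. 0 \<le> h x" "integrable \<mu>0 h"
    "\<And>f \<pi>s. f \<in> LIPb \<Longrightarrow> \<pi>s \<in> LIP_tuples k \<Longrightarrow>
       \<bar>T f \<pi>s\<bar> \<le> prod_Lip k \<pi>s * (\<integral>x. h x * \<bar>f x\<bar> \<partial>\<mu>0)" for h
    using that by (auto simp: H_def mass_bound_density s\<mu>)
  have H1: "(\<lambda>x. 1) \<in> H"
    using \<mu>0 by (intro HI) (auto simp: mass_bound_prod_Lip)
  have Hmin: "(\<lambda>x. min (h x) (h' x)) \<in> H" if h: "h \<in> H" and h': "h' \<in> H" for h h'
  proof (rule HI)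
    note [measurable] = HD(1)[OF h] HD(1)[OF h']
    fix f :: "'a \<Rightarrow> real" and \<pi>s :: "('a \<Rightarrow> real) list" assume f: "f \<in> LIPb" and \<pi>s: "\<pi>s \<in> LIP_tuples k"
    have [measurable]: "f \<in> borel_measurable borel"
      using f by (intro bcontfun_measurable LIPb_bcontfun)
    obtain B where B: "0 \<le> B" "\<And>x. \<bar>f x\<bar> \<le> B" using bcontfun_boundE[OF LIPb_bcontfun[OF f]] by metis
    \<comment> \<open>Gluing along the set where \<open>h\<close> is the smaller density produces
      exactly the measure with density the pointwise minimum.\<close>
    define A where "A = {x. h x \<le> h' x}"
    have [measurable]: "A \<in> sets borel" unfolding A_def by simp
    have "\<bar>T f \<pi>s\<bar> \<le> prod_Lip k \<pi>s * ((\<integral>x. indicator A x * \<bar>f x\<bar> \<partial>density \<mu>0 h) +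
        (\<integral>x. indicator (- A) x * \<bar>f x\<bar> \<partial>density \<mu>0 h'))"
      by (intro mass_bound_split[OF T] HD h h' f \<pi>s) simp
    also have "(\<integral>x. indicator A x * \<bar>f x\<bar> \<partial>density \<mu>0 h) = (\<integral>x. h x * (indicator A x * \<bar>f x\<bar>) \<partial>\<mu>0)"
      by (rule integral_real_density) (auto simp: HD[OF h])
    also have "(\<integral>x. indicator (- A) x * \<bar>f x\<bar> \<partial>density \<mu>0 h') =
        (\<integral>x. h' x * (indicator (- A) x * \<bar>f x\<bar>) \<partial>\<mu>0)"
      by (rule integral_real_density) (auto simp: HD[OF h'])
    also have "(\<integral>x. h x * (indicator A x * \<bar>f x\<bar>) \<partial>\<mu>0) + (\<integral>x. h' x * (indicator (- A) x * \<bar>f x\<bar>) \<partial>\<mu>0)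
        = (\<integral>x. h x * (indicator A x * \<bar>f x\<bar>) + h' x * (indicator (- A) x * \<bar>f x\<bar>) \<partial>\<mu>0)"
      by (intro Bochner_Integration.integral_add[symmetric] integrable_mult_bounded[where B = B] HD h h')
        (use B in \<open>auto split: split_indicator\<close>)
    also have "\<dots> = (\<integral>x. min (h x) (h' x) * \<bar>f x\<bar> \<partial>\<mu>0)"
      by (intro Bochner_Integration.integral_cong) (auto simp: A_def min_def split: split_indicator)
    finally show "\<bar>T f \<pi>s\<bar> \<le> prod_Lip k \<pi>s * (\<integral>x. min (h x) (h' x) * \<bar>f x\<bar> \<partial>\<mu>0)" .
  qed (use HD[OF h] HD[OF h'] in auto)
  \<comment> \<open>The infimum is over a nonempty set, since the constant 1 is the density of
    \<open>\<mu>0\<close> itself, and it is bounded below by 0.\<close>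
  define c where "c = Inf ((\<lambda>h. \<integral>x. h x \<partial>\<mu>0) ` H)"
  have c_le: "c \<le> (\<integral>x. h x \<partial>\<mu>0)" if "h \<in> H" for h
    unfolding c_def using that HD
    by (intro cINF_lower) (auto intro!: bdd_belowI[of _ 0] integral_nonneg)
  have "\<exists>h\<in>H. (\<integral>x. h x \<partial>\<mu>0) < c + inverse (real (Suc i))" for i
  proof -
    have "c < c + inverse (real (Suc i))" by simp
    then obtain r where "r \<in> (\<lambda>h. \<integral>x. h x \<partial>\<mu>0) ` H" "r < c + inverse (real (Suc i))"
      using H1 unfolding c_def by (metis cInf_lessD empty_iff image_eqI)
    then show ?thesis by auto
  qed
  then obtain h where h: "\<And>i. h i \<in> H" "\<And>i. (\<integral>x. h i x \<partial>\<mu>0) < c + inverse (real (Suc i))" by metis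
  \<comment> \<open>Running minima of a minimising sequence: they stay in \<open>H\<close>, decrease
    pointwise, and have total mass no larger than that of the sequence.\<close>
  define G where "G = rec_nat (h 0) (\<lambda>i g x. min (g x) (h (Suc i) x))"
  have G_simps: "G 0 = h 0" "G (Suc i) = (\<lambda>x. min (G i x) (h (Suc i) x))" for i
    by (auto simp: G_def)
  have GH: "G i \<in> H" for i by (induction i) (auto simp: G_simps h intro!: Hmin)
  have dec: "decseq (\<lambda>i. G i x)" for x by (rule decseq_SucI) (simp add: G_simps)
  have Gh: "G i x \<le> h i x" for i x by (cases i) (auto simp: G_simps)
  have "\<exists>l. (\<lambda>i. G i x) \<longlonglongrightarrow> l" for x
    using decseq_convergent[OF dec[of x], of 0] HD(2)[OF GH] by metis
  then obtain g where lim: "\<And>x. (\<lambda>i. G i x) \<longlonglongrightarrow> g x" by metis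
  have g0: "0 \<le> g x" for x by (rule LIMSEQ_le_const[OF lim]) (use HD(2)[OF GH] in auto)
  have [measurable]: "G i \<in> borel_measurable borel" for i by (rule HD(1)[OF GH])
  have gm[measurable]: "g \<in> borel_measurable borel" by (rule borel_measurable_LIMSEQ_real[OF lim]) simp
  \<comment> \<open>The first term of the decreasing sequence is the integrable majorant for all
    limits that follow.\<close>
  have G0: "\<bar>G i x\<bar> \<le> G 0 x" for i x using decseqD[OF dec, of 0 i x] HD(2)[OF GH, of i x] by simp
  have gint: "integrable \<mu>0 g"
    by (rule integrable_dominated_convergence[where s = G and w = "G 0"])
      (auto simp: lim G0 intro!: HD(3)[OF GH])
  have "(\<lambda>i. \<integral>x. G i x \<partial>\<mu>0) \<longlonglongrightarrow> (\<integral>x. g x \<partial>\<mu>0)"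
    by (rule integral_dominated_convergence[where w = "G 0"])
      (auto simp: lim G0 intro!: HD(3)[OF GH])
  moreover have "(\<integral>x. G i x \<partial>\<mu>0) \<le> c + inverse (real (Suc i))" for i
    using integral_mono[OF HD(3)[OF GH] HD(3)[OF h(1)] Gh, of i] h(2)[of i] by linarith
  moreover have "(\<lambda>i. c + inverse (real (Suc i))) \<longlonglongrightarrow> c + 0"
    by (intro tendsto_intros LIMSEQ_inverse_real_of_nat)
  ultimately have gc: "(\<integral>x. g x \<partial>\<mu>0) \<le> c"
    by (auto intro: LIMSEQ_le)
  have gH: "g \<in> H"
  proof (rule HI)
    fix f :: "'a \<Rightarrow> real" and \<pi>s :: "('a \<Rightarrow> real) list" assume f: "f \<in> LIPb" and \<pi>s: "\<pi>s \<in> LIP_tuples k"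
    have [measurable]: "f \<in> borel_measurable borel"
      using f by (intro bcontfun_measurable LIPb_bcontfun)
    obtain B where B: "0 \<le> B" "\<And>x. \<bar>f x\<bar> \<le> B" using bcontfun_boundE[OF LIPb_bcontfun[OF f]] by metis
    have "(\<lambda>i. \<integral>x. G i x * \<bar>f x\<bar> \<partial>\<mu>0) \<longlonglongrightarrow> (\<integral>x. g x * \<bar>f x\<bar> \<partial>\<mu>0)"
    proof (rule integral_dominated_convergence[where w = "\<lambda>x. G 0 x * B"])
      show "integrable \<mu>0 (\<lambda>x. G 0 x * B)" using HD(3)[OF GH, of 0] by simp
      show "AE x in \<mu>0. norm (G i x * \<bar>f x\<bar>) \<le> G 0 x * B" for i
        using mult_mono[OF G0 B(2)] HD(2)[OF GH] by (auto simp: abs_mult)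
    qed (auto intro!: tendsto_intros lim)
    then have "(\<lambda>i. prod_Lip k \<pi>s * (\<integral>x. G i x * \<bar>f x\<bar> \<partial>\<mu>0)) \<longlonglongrightarrow>
        prod_Lip k \<pi>s * (\<integral>x. g x * \<bar>f x\<bar> \<partial>\<mu>0)"
      by (intro tendsto_intros)
    then show "\<bar>T f \<pi>s\<bar> \<le> prod_Lip k \<pi>s * (\<integral>x. g x * \<bar>f x\<bar> \<partial>\<mu>0)"
      by (rule LIMSEQ_le_const) (use Hbound[OF GH f \<pi>s] in auto)
  qed (use g0 gint in auto)
  show ?thesis
  proof (rule that[of g])
    fix h assume "h \<in> borel_measurable borel" "\<And>x. 0 \<le> h x" "integrable \<mu>0 h"
      "mass_bound k T (density \<mu>0 h)"
    then have "h \<in> H" by (simp add: H_def)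
    then show "(\<integral>x. g x \<partial>\<mu>0) \<le> (\<integral>x. h x \<partial>\<mu>0)" using gc c_le by force
  qed (use HD[OF gH] in auto)
qed

text \<open>The minimiser among densities also lies below a bound \<open>\<nu>\<close> that is not
  absolutely continuous with respect to \<open>\<mu>0\<close>. A Hahn set \<open>Y\<close> separates
  the region where \<open>\<nu>\<close> is dominated by \<open>\<mu>\<close> from the one where it
  dominates. Off \<open>Y\<close> there is nothing to prove; on \<open>Y\<close> the measure
  \<open>\<nu>\<close> does have a density, and least total mass forces equality of the two measures
  there.\<close>

lemma mass_bound_minimal_exists:
  fixes T :: "('a::polish_space \<Rightarrow> real) \<Rightarrow> ('a \<Rightarrow> real) list \<Rightarrow> real"
  assumes T: "multilinear k T" and \<mu>0: "mass_bound k T \<mu>0"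
  obtains \<mu> where "mass_bound k T \<mu>"
    "\<And>\<nu> A. mass_bound k T \<nu> \<Longrightarrow> A \<in> sets borel \<Longrightarrow> emeasure \<mu> A \<le> emeasure \<nu> A"
proof -
  have s\<mu>0: "finite_measure \<mu>0" "sets \<mu>0 = sets borel" using \<mu>0 by (auto simp: mass_bound_def)
  interpret \<mu>0: finite_measure \<mu>0 by fact
  note [measurable_cong] = s\<mu>0(2)
  obtain g where gm[measurable]: "g \<in> borel_measurable borel" and g0: "\<And>x. 0 \<le> g x"
    and gint: "integrable \<mu>0 g" and gbound: "mass_bound k T (density \<mu>0 g)"
    and least: "\<And>h. h \<in> borel_measurable borel \<Longrightarrow> (\<And>x. 0 \<le> h x) \<Longrightarrow> integrable \<mu>0 h \<Longrightarrow>
       mass_bound k T (density \<mu>0 h) \<Longrightarrow> (\<integral>x. g x \<partial>\<mu>0) \<le> (\<integral>x. h x \<partial>\<mu>0)"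
    using mass_bound_least_density[OF T \<mu>0] by metis
  define \<mu> where "\<mu> = density \<mu>0 g"
  have s\<mu>: "finite_measure \<mu>" "sets \<mu> = sets borel"
    using gbound unfolding \<mu>_def mass_bound_def by blast+
  interpret \<mu>: finite_measure \<mu> by fact
  have "emeasure \<mu> E \<le> emeasure \<nu> E" if \<nu>: "mass_bound k T \<nu>" and E: "E \<in> sets borel" for \<nu> E
  proof -
    have s\<nu>: "finite_measure \<nu>" "sets \<nu> = sets borel" using \<nu> by (auto simp: mass_bound_def)
    interpret \<nu>: finite_measure \<nu> by fact
    note [measurable_cong] = s\<nu>(2)
    note [measurable] = E
    have "\<exists>Y\<in>sets \<mu>. (\<forall>X\<in>sets \<mu>. X \<subseteq> Y \<longrightarrow> emeasure \<nu> X \<le> emeasure \<mu> X) \<and>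
        (\<forall>X\<in>sets \<mu>. X \<inter> Y = {} \<longrightarrow> emeasure \<mu> X \<le> emeasure \<nu> X)"
      by (rule finite_unsigned_Hahn_decomposition) (use s\<mu> s\<nu> in auto)
    then obtain Y where Y': "Y \<in> sets \<mu>"
      and sub': "\<forall>X\<in>sets \<mu>. X \<subseteq> Y \<longrightarrow> emeasure \<nu> X \<le> emeasure \<mu> X"
      and dis': "\<forall>X\<in>sets \<mu>. X \<inter> Y = {} \<longrightarrow> emeasure \<mu> X \<le> emeasure \<nu> X"
      by (elim bexE conjE)
    note Y[measurable] = Y'[unfolded s\<mu>(2)]
    note sub = sub'[unfolded s\<mu>(2), rule_format] and dis = dis'[unfolded s\<mu>(2), rule_format]
    text \<open>Replacing \<open>\<mu>\<close> by \<open>\<nu>\<close> on \<open>Y\<close> gives another bound with a density, to which the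
      minimality of \<open>g\<close> applies.\<close>
    define \<nu>Y where "\<nu>Y = density \<nu> (indicator Y)"
    have em\<nu>Y: "emeasure \<nu>Y X = emeasure \<nu> (X \<inter> Y)" if "X \<in> sets borel" for X
    proof -
      note [measurable] = that
      have "emeasure \<nu>Y X = (\<integral>\<^sup>+x. indicator Y x * indicator X x \<partial>\<nu>)"
        unfolding \<nu>Y_def by (rule emeasure_density) measurable
      also have "\<dots> = (\<integral>\<^sup>+x. indicator (X \<inter> Y) x \<partial>\<nu>)"
        by (intro nn_integral_cong) (simp split: split_indicator)
      finally show ?thesis by simp
    qed
    have s\<nu>Y: "finite_measure \<nu>Y" "sets \<nu>Y = sets borel"
    proof -
      show "sets \<nu>Y = sets borel" by (simp add: \<nu>Y_def s\<nu>)
      then show "finite_measure \<nu>Y"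
        by (intro finite_measureI) (simp add: em\<nu>Y sets_eq_imp_space_eq)
    qed
    \<comment> \<open>This is where the choice of \<open>Y\<close> matters: there
      \<open>\<nu>\<close> lies below \<open>\<mu>\<close>, which has a density and hence ignores
      null sets of \<open>\<mu>0\<close>.\<close>
    have ac: "absolutely_continuous \<mu>0 \<nu>Y"
      unfolding absolutely_continuous_def
    proof
      fix N assume N: "N \<in> null_sets \<mu>0"
      then have [measurable]: "N \<in> sets borel" using s\<mu>0 by auto
      have "emeasure \<mu> N = 0"
        using N unfolding \<mu>_def
        by (subst emeasure_density) (auto simp: null_sets_def intro!: nn_integral_null_set[unfolded null_sets_def])
      then have "emeasure \<mu> (N \<inter> Y) = 0"
        by (metis Int_lower1 emeasure_mono le_zero_eq s\<mu>(2) \<open>N \<in> sets borel\<close>)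
      then have "emeasure \<nu>Y N = 0" using sub[of "N \<inter> Y"] by (simp add: em\<nu>Y)
      then show "N \<in> null_sets \<nu>Y" using s\<nu>Y by auto
    qed
    obtain D where D: "D \<in> borel_measurable \<mu>0" "AE x in \<mu>0. RN_deriv \<mu>0 \<nu>Y x = ennreal (D x)"
      "\<And>x. 0 \<le> D x"
      by (rule \<mu>0.real_RN_deriv[OF s\<nu>Y(1) ac]) (simp_all add: s\<nu>Y s\<mu>0)
    have Dm[measurable]: "D \<in> borel_measurable borel" using D(1) by simp
    have "density \<mu>0 D = density \<mu>0 (RN_deriv \<mu>0 \<nu>Y)"
      using D by (intro density_cong) auto
    also have "\<dots> = \<nu>Y" by (rule \<mu>0.density_RN_deriv[OF ac]) (simp add: s\<nu>Y s\<mu>0)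
    finally have dD: "density \<mu>0 D = \<nu>Y" .
    have Dint: "integrable \<mu>0 D"
    proof -
      have "integrable (density \<mu>0 D) (\<lambda>x. 1 :: real)"
        unfolding dD using s\<nu>Y(1) by (simp add: finite_measure.integrable_const)
      then show ?thesis using D(3) by (subst (asm) integrable_real_density) auto
    qed
    define h where "h x = indicator Y x * D x + indicator (- Y) x * g x" for x
    have h0: "0 \<le> h x" for x using D(3) g0 by (simp add: h_def)
    have hm[measurable]: "h \<in> borel_measurable borel" unfolding h_def by measurable
    \<comment> \<open>Used twice: with u = |f| to see that the glued measure is a mass bound, and
      with u = 1 to compute its total mass.\<close>
    have hu: "(\<integral>x. h x * u x \<partial>\<mu>0) = (\<integral>x. indicator Y x * u x \<partial>\<nu>) + (\<integral>x. indicator (- Y) x * u x \<partial>\<mu>)"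
      "integrable \<mu>0 (\<lambda>x. h x * u x)"
      if um[measurable]: "u \<in> borel_measurable borel" and uB: "\<And>x. \<bar>u x\<bar> \<le> B" for u :: "'a \<Rightarrow> real" and B
    proof -
      have "0 \<le> B" using order_trans[OF abs_ge_zero uB] .
      then have i1: "integrable \<mu>0 (\<lambda>x. D x * (indicator Y x * u x))"
        using uB by (intro integrable_mult_bounded[where B = B] Dint) (auto split: split_indicator)
      have i2: "integrable \<mu>0 (\<lambda>x. g x * (indicator (- Y) x * u x))"
        using uB \<open>0 \<le> B\<close> by (intro integrable_mult_bounded[where B = B] gint) (auto split: split_indicator)
      have eq: "h x * u x = D x * (indicator Y x * u x) + g x * (indicator (- Y) x * u x)" for x
        by (simp add: h_def algebra_simps)
      show "integrable \<mu>0 (\<lambda>x. h x * u x)"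
        unfolding eq using i1 i2 by (rule Bochner_Integration.integrable_add)
      have "(\<integral>x. h x * u x \<partial>\<mu>0) = (\<integral>x. D x * (indicator Y x * u x) \<partial>\<mu>0) +
          (\<integral>x. g x * (indicator (- Y) x * u x) \<partial>\<mu>0)"
        unfolding eq using i1 i2 by (rule Bochner_Integration.integral_add)
      also have "(\<integral>x. D x * (indicator Y x * u x) \<partial>\<mu>0) = (\<integral>x. indicator Y x * u x \<partial>\<nu>Y)"
        unfolding dD[symmetric] using D(3) by (intro integral_real_density[symmetric]) auto
      also have "\<dots> = (\<integral>x. indicator Y x * (indicator Y x * u x) \<partial>\<nu>)"
        unfolding \<nu>Y_def ennreal_indicator[symmetric] by (rule integral_real_density) auto
      also have "\<dots> = (\<integral>x. indicator Y x * u x \<partial>\<nu>)"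
        by (rule Bochner_Integration.integral_cong) (auto split: split_indicator)
      also have "(\<integral>x. g x * (indicator (- Y) x * u x) \<partial>\<mu>0) = (\<integral>x. indicator (- Y) x * u x \<partial>\<mu>)"
        unfolding \<mu>_def using g0 by (intro integral_real_density[symmetric]) auto
      finally show "(\<integral>x. h x * u x \<partial>\<mu>0) =
        (\<integral>x. indicator Y x * u x \<partial>\<nu>) + (\<integral>x. indicator (- Y) x * u x \<partial>\<mu>)" .
    qed
    have hint: "integrable \<mu>0 h" using hu(2)[of "\<lambda>_. 1" 1] by simp
    have "mass_bound k T (density \<mu>0 h)"
      unfolding mass_bound_density[OF s\<mu>0(2) hm h0 hint]
    proof (intro ballI)
      fix f :: "'a \<Rightarrow> real" and \<pi>s :: "('a \<Rightarrow> real) list" assume f: "f \<in> LIPb" and \<pi>s: "\<pi>s \<in> LIP_tuples k"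
      have [measurable]: "f \<in> borel_measurable borel"
        using f by (intro bcontfun_measurable LIPb_bcontfun)
      obtain B where B: "\<And>x. \<bar>f x\<bar> \<le> B" using bcontfun_boundE[OF LIPb_bcontfun[OF f]] by metis
      have "(\<integral>x. h x * \<bar>f x\<bar> \<partial>\<mu>0) =
          (\<integral>x. indicator Y x * \<bar>f x\<bar> \<partial>\<nu>) + (\<integral>x. indicator (- Y) x * \<bar>f x\<bar> \<partial>\<mu>)"
        by (rule hu[where B = B]) (use B in auto)
      then show "\<bar>T f \<pi>s\<bar> \<le> prod_Lip k \<pi>s * (\<integral>x. h x * \<bar>f x\<bar> \<partial>\<mu>0)"
        using mass_bound_split[OF T \<nu> gbound Y f \<pi>s] by (simp add: \<mu>_def)
    qed
    then have "(\<integral>x. g x \<partial>\<mu>0) \<le> (\<integral>x. h x \<partial>\<mu>0)" by (intro least hm h0 hint)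
    also have "\<dots> = measure \<nu> Y + measure \<mu> (- Y)"
      using hu(1)[of "\<lambda>_. 1" 1] s\<mu> s\<nu> by simp
    also have "(\<integral>x. g x \<partial>\<mu>0) = (\<integral>x. 1 \<partial>\<mu>)"
      unfolding \<mu>_def using g0 by (subst integral_real_density) auto
    also have "\<dots> = measure \<mu> UNIV" using s\<mu> by (simp add: sets_eq_imp_space_eq)
    also have "\<dots> = measure \<mu> Y + measure \<mu> (- Y)"
      using \<mu>.finite_measure_Union[of Y "- Y"] s\<mu> by (simp add: Un_commute)
    finally have "measure \<mu> Y \<le> measure \<nu> Y" by simp
    \<comment> \<open>Total mass was compared only on all of \<open>Y\<close>. Since the opposite
      inequality holds on \<open>Y - E\<close>, subtracting it leaves the wanted one on the part of
      \<open>E\<close> inside \<open>Y\<close>.\<close>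
    moreover have "measure \<nu> (Y - E) \<le> measure \<mu> (Y - E)"
      using sub[of "Y - E"] by (simp add: \<mu>.emeasure_eq_measure \<nu>.emeasure_eq_measure)
    moreover have "measure \<mu> (E - Y) \<le> measure \<nu> (E - Y)"
      using dis[of "E - Y"] by (simp add: Int_commute[of _ Y] \<mu>.emeasure_eq_measure \<nu>.emeasure_eq_measure)
    moreover have "measure M Y = measure M (E \<inter> Y) + measure M (Y - E)"
      "measure M E = measure M (E \<inter> Y) + measure M (E - Y)"
      if "finite_measure M" "sets M = sets borel" for M :: "'a measure"
    proof -
      interpret finite_measure M by fact
      have "E \<inter> Y \<union> (Y - E) = Y" "E \<inter> Y \<union> (E - Y) = E" by auto
      then show "measure M Y = measure M (E \<inter> Y) + measure M (Y - E)"
        "measure M E = measure M (E \<inter> Y) + measure M (E - Y)"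
        using finite_measure_Union[of "E \<inter> Y" "Y - E"] finite_measure_Union[of "E \<inter> Y" "E - Y"] that(2)
        by (simp_all add: disjoint_iff)
    qed
    note this[OF s\<mu>] this[OF s\<nu>]
    ultimately have "measure \<mu> E \<le> measure \<nu> E" by linarith
    then show ?thesis by (simp add: \<mu>.emeasure_eq_measure \<nu>.emeasure_eq_measure)
  qed
  then show ?thesis using gbound that[of \<mu>] by (simp add: \<mu>_def)
qed

text \<open>\<open>AK_mass\<close> is a definite description and carries no information before
  existence and uniqueness are known. Two minimal bounds dominate each other on all Borel sets,
  hence coincide.\<close>

lemma AK_mass_minimal:
  fixes T :: "('a::polish_space \<Rightarrow> real) \<Rightarrow> ('a \<Rightarrow> real) list \<Rightarrow> real"
  assumes "multilinear k T" and "mass_bound k T \<mu>0"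
  shows "mass_bound k T (AK_mass k T)"
    and "A \<in> sets borel \<Longrightarrow> emeasure (AK_mass k T) A \<le> emeasure \<mu>0 A"
proof -
  let ?P = "\<lambda>\<mu>. mass_bound k T \<mu> \<and>
    (\<forall>\<nu>. mass_bound k T \<nu> \<longrightarrow> (\<forall>A\<in>sets borel. emeasure \<mu> A \<le> emeasure \<nu> A))"
  have "\<exists>\<mu>. ?P \<mu>" using mass_bound_minimal_exists[OF assms] by metis
  moreover have "\<mu> = \<nu>" if "?P \<mu>" "?P \<nu>" for \<mu> \<nu>
  proof (rule measure_eqI)
    show s: "sets \<mu> = sets \<nu>" using that by (simp add: mass_bound_def)
    show "emeasure \<mu> A = emeasure \<nu> A" if "A \<in> sets \<mu>" for A
      using \<open>?P \<mu>\<close> \<open>?P \<nu>\<close> that by (auto simp: mass_bound_def intro!: antisym)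
  qed
  ultimately have "\<exists>!\<mu>. ?P \<mu>" by blast
  then have *: "?P (AK_mass k T)" unfolding AK_mass_def by (rule theI')
  show "mass_bound k T (AK_mass k T)" using * by blast
  show "A \<in> sets borel \<Longrightarrow> emeasure (AK_mass k T) A \<le> emeasure \<mu>0 A" using * assms(2) by blast
qed

section \<open>Currents as linear maps on tensors\<close>

lemma abs_tensor_eqI: "tensor_eq v w \<Longrightarrow> abs_tensor v = abs_tensor w"
  by (rule Quotient_rel_abs[OF Quotient_tensor])

lemma dform_add:
  assumes "f \<in> bcontfun" "g \<in> bcontfun" "set \<pi>s \<subseteq> LIP"
  shows "dform (\<lambda>x. f x + g x) \<pi>s = dform f \<pi>s + dform g \<pi>s"
  unfolding dform_def abs_tensor_eqI[OF tensor_eq.add_coeff[OF assms]]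
  by (subst plus_tensor.abs_eq) (use assms in \<open>auto simp: tensor_eq_refl_iff add_mset_commute\<close>)

lemma dform_scale:
  assumes "f \<in> bcontfun" "set \<pi>s \<subseteq> LIP"
  shows "dform (\<lambda>x. c * f x) \<pi>s = c *\<^sub>R dform f \<pi>s"
  unfolding dform_def
  by (subst scaleR_tensor.abs_eq) (use assms in \<open>auto simp: tensor_eq_refl_iff\<close>)

lemma dform_add_slot:
  assumes "f \<in> bcontfun" "set (\<pi>s @ p # q # \<rho>s) \<subseteq> LIP"
  shows "dform f (\<pi>s @ (\<lambda>x. p x + q x) # \<rho>s) = dform f (\<pi>s @ p # \<rho>s) + dform f (\<pi>s @ q # \<rho>s)"
  unfolding dform_def abs_tensor_eqI[OF tensor_eq.add_slot[OF assms]]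
  by (subst plus_tensor.abs_eq) (use assms in \<open>auto simp: tensor_eq_refl_iff add_mset_commute\<close>)

lemma dform_scale_slot:
  assumes "f \<in> bcontfun" "set (\<pi>s @ p # \<rho>s) \<subseteq> LIP"
  shows "dform f (\<pi>s @ (\<lambda>x. c * p x) # \<rho>s) = c *\<^sub>R dform f (\<pi>s @ p # \<rho>s)"
proof -
  have "dform f (\<pi>s @ (\<lambda>x. c * p x) # \<rho>s) = dform (\<lambda>x. c * f x) (\<pi>s @ p # \<rho>s)"
    unfolding dform_def by (rule abs_tensor_eqI[OF tensor_eq.scale[OF assms], symmetric])
  then show ?thesis by (simp only: dform_scale[OF assms])
qed

text \<open>The required identities already hold between the tensors \<open>dform f \<pi>s\<close>,
  so every linear functional on tensors inherits them.\<close>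

lemma multilinear_of_linear:
  fixes M :: "'a::metric_space tensor \<Rightarrow> real"
  assumes M: "linear M"
  shows "multilinear k (\<lambda>f \<pi>s. M (dform f \<pi>s))"
  unfolding multilinear_def
proof (intro conjI ballI allI impI)
  fix f g :: "'a \<Rightarrow> real" and \<pi>s :: "('a \<Rightarrow> real) list" and a b :: real
  assume "f \<in> LIPb" "g \<in> LIPb" "\<pi>s \<in> LIP_tuples k"
  then have *: "f \<in> bcontfun" "g \<in> bcontfun" "set \<pi>s \<subseteq> LIP"
    by (auto simp: LIP_tuples_def intro: LIPb_bcontfun)
  have "dform (\<lambda>x. a * f x + b * g x) \<pi>s = a *\<^sub>R dform f \<pi>s + b *\<^sub>R dform g \<pi>s"
    by (subst dform_add) (simp_all add: * dform_scale bcontfun_mult_real)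
  then show "M (dform (\<lambda>x. a * f x + b * g x) \<pi>s) = a * M (dform f \<pi>s) + b * M (dform g \<pi>s)"
    by (simp add: linear_add[OF M] linear_cmul[OF M])
next
  fix f p q :: "'a \<Rightarrow> real" and \<pi>s \<rho>s :: "('a \<Rightarrow> real) list" and a b :: real
  assume "f \<in> LIPb" "\<pi>s @ p # \<rho>s \<in> LIP_tuples k" "q \<in> LIP"
  then have *: "f \<in> bcontfun" "set \<pi>s \<subseteq> LIP" "p \<in> LIP" "q \<in> LIP" "set \<rho>s \<subseteq> LIP"
    by (auto simp: LIP_tuples_def intro: LIPb_bcontfun)
  have "dform f (\<pi>s @ (\<lambda>x. a * p x + b * q x) # \<rho>s) =
      a *\<^sub>R dform f (\<pi>s @ p # \<rho>s) + b *\<^sub>R dform f (\<pi>s @ q # \<rho>s)"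
    by (subst dform_add_slot) (simp_all add: * dform_scale_slot LIP_cmult)
  then show "M (dform f (\<pi>s @ (\<lambda>x. a * p x + b * q x) # \<rho>s)) =
      a * M (dform f (\<pi>s @ p # \<rho>s)) + b * M (dform f (\<pi>s @ q # \<rho>s))"
    by (simp add: linear_add[OF M] linear_cmul[OF M])
qed

lemma linear_dform_diff:
  fixes f g :: "'a::metric_space \<Rightarrow> real" and M :: "'a tensor \<Rightarrow> real"
  assumes "linear M" "f \<in> bcontfun" "g \<in> bcontfun" "set \<pi>s \<subseteq> LIP"
  shows "M (dform (\<lambda>x. f x - g x) \<pi>s) = M (dform f \<pi>s) - M (dform g \<pi>s)"
proof -
  have "dform (\<lambda>x. f x + - 1 * g x) \<pi>s = dform f \<pi>s + - 1 *\<^sub>R dform g \<pi>s"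
    using assms dform_scale[OF assms(3,4), of "- 1"] bcontfun_mult_real[OF bcontfun_const_real[of "- 1"] assms(3)]
    by (subst dform_add) auto
  then show ?thesis by (simp add: linear_diff[OF assms(1)])
qed

section \<open>Currents with bounded continuous coefficients\<close>

lemma integral_approx_diff_tendsto:
  fixes f :: "'a::metric_space \<Rightarrow> real"
  assumes \<mu>: "finite_measure \<mu>" "sets \<mu> = sets borel"
    and f: "f \<in> bcontfun" and F: "\<And>i. F i \<in> LIPb" and B: "\<And>i x. \<bar>F i x\<bar> \<le> B"
    and lim: "\<And>x. (\<lambda>i::nat. F i x) \<longlonglongrightarrow> f x"
  shows "(\<lambda>i. \<integral>x. \<bar>f x - F i x\<bar> \<partial>\<mu>) \<longlonglongrightarrow> 0"
proof -
  obtain C where C: "\<And>x. \<bar>f x\<bar> \<le> C" using bcontfun_boundE[OF f] by metis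
  have [measurable]: "f \<in> borel_measurable borel" "F i \<in> borel_measurable borel" for i
    using f F by (auto intro: bcontfun_measurable LIPb_bcontfun)
  have "(\<lambda>i. \<integral>x. \<bar>f x - F i x\<bar> \<partial>\<mu>) \<longlonglongrightarrow> (\<integral>x. 0 \<partial>\<mu>)"
  proof (rule integral_bcontfun_tendsto[OF \<mu>])
    show "\<bar>\<bar>f x - F i x\<bar>\<bar> \<le> C + B" for i x using B[of i x] C[of x] by linarith
    show "(\<lambda>i. \<bar>f x - F i x\<bar>) \<longlonglongrightarrow> 0" for x
      using tendsto_rabs[OF tendsto_diff[OF tendsto_const lim], of "f x" x] by simp
  qed simp_all
  then show ?thesis by simp
qed

lemma currentD:
  assumes "current k T"
  shows "1 \<le> k" "multilinear k T" "\<exists>\<mu>. mass_bound k T \<mu>"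
    and "f \<in> LIPb \<Longrightarrow> \<pi>s \<in> LIP_tuples k \<Longrightarrow> (\<And>i::nat. p i \<in> LIP_tuples k) \<Longrightarrow>
      (\<And>j. j < k \<Longrightarrow> \<exists>K. \<forall>i. K-lipschitz_on UNIV (p i ! j)) \<Longrightarrow>
      (\<And>j x. j < k \<Longrightarrow> (\<lambda>i. (p i ! j) x) \<longlonglongrightarrow> (\<pi>s ! j) x) \<Longrightarrow> (\<lambda>i. T f (p i)) \<longlonglongrightarrow> T f \<pi>s"
    and "f \<in> LIPb \<Longrightarrow> \<pi>s \<in> LIP_tuples k \<Longrightarrow> j < k \<Longrightarrow> open U \<Longrightarrow> {x. f x \<noteq> 0} \<subseteq> U \<Longrightarrow>
      (\<And>x. x \<in> U \<Longrightarrow> (\<pi>s ! j) x = c) \<Longrightarrow> T f \<pi>s = 0"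
proof -
  note T = assms[unfolded current_def]
  show "1 \<le> k" "multilinear k T" "\<exists>\<mu>. mass_bound k T \<mu>"
    by (intro T[THEN conjunct1] T[THEN conjunct2, THEN conjunct1]
      T[THEN conjunct2, THEN conjunct2, THEN conjunct1])+
  note T' = T[THEN conjunct2, THEN conjunct2, THEN conjunct2]
  show "(\<lambda>i. T f (p i)) \<longlonglongrightarrow> T f \<pi>s"
    if "f \<in> LIPb" "\<pi>s \<in> LIP_tuples k" "\<And>i. p i \<in> LIP_tuples k"
      "\<And>j. j < k \<Longrightarrow> \<exists>K. \<forall>i. K-lipschitz_on UNIV (p i ! j)"
      "\<And>j x. j < k \<Longrightarrow> (\<lambda>i. (p i ! j) x) \<longlonglongrightarrow> (\<pi>s ! j) x"
    using that by (rule T'[THEN conjunct1, rule_format])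
  show "T f \<pi>s = 0"
    if "f \<in> LIPb" "\<pi>s \<in> LIP_tuples k" "j < k" "open U" "{x. f x \<noteq> 0} \<subseteq> U"
      "\<And>x. x \<in> U \<Longrightarrow> (\<pi>s ! j) x = c"
  proof (rule T'[THEN conjunct2, rule_format, OF that(1,2)])
    have "\<forall>x\<in>U. (\<pi>s ! j) x = c" using that(6) by simp
    then show "\<exists>j<k. \<exists>U c. open U \<and> {x. f x \<noteq> 0} \<subseteq> U \<and> (\<forall>x\<in>U. (\<pi>s ! j) x = c)"
      using that(3-5) by (intro exI[of _ j] conjI exI[of _ U] exI[of _ c])
  qed
qed

lemma current_mass_bound:
  fixes T :: "('a::polish_space \<Rightarrow> real) \<Rightarrow> ('a \<Rightarrow> real) list \<Rightarrow> real"
  assumes "current k T"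
  shows "mass_bound k T (AK_mass k T)"
proof -
  obtain \<mu> where "mass_bound k T \<mu>" using currentD(3)[OF assms] by (rule exE)
  then show ?thesis by (rule AK_mass_minimal(1)[OF currentD(2)[OF assms]])
qed

text \<open>Any continuity of \<open>L\<close> in the coefficient for some $L^1$ norm yields the mass inequality, by
  density of the bounded Lipschitz functions.\<close>

lemma acts_asI:
  fixes T :: "('a::polish_space \<Rightarrow> real) \<Rightarrow> ('a \<Rightarrow> real) list \<Rightarrow> real"
  assumes T: "current k T" and L: "linear L"
    and eq: "\<And>f \<pi>s. f \<in> LIPb \<Longrightarrow> \<pi>s \<in> LIP_tuples k \<Longrightarrow> L (dform f \<pi>s) = T f \<pi>s"
    and \<nu>: "finite_measure \<nu>" "sets \<nu> = sets borel"
    and bound: "\<And>f \<pi>s. f \<in> bcontfun \<Longrightarrow> \<pi>s \<in> LIP_tuples k \<Longrightarrow>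
      \<bar>L (dform f \<pi>s)\<bar> \<le> C \<pi>s * (\<integral>x. \<bar>f x\<bar> \<partial>\<nu>)"
  shows "acts_as k T L"
  unfolding acts_as_def
proof (intro conjI ballI L)
  fix f :: "'a \<Rightarrow> real" and \<pi>s :: "('a \<Rightarrow> real) list"
  assume f: "f \<in> bcontfun" and \<pi>s: "\<pi>s \<in> LIP_tuples k"
  then have LIP: "set \<pi>s \<subseteq> LIP" by (simp add: LIP_tuples_def)
  let ?\<mu> = "AK_mass k T"
  have mb: "mass_bound k T ?\<mu>" using T by (rule current_mass_bound)
  obtain F B where F: "\<And>i::nat. F i \<in> LIPb" "\<And>i x. \<bar>F i x\<bar> \<le> B" "\<And>x. (\<lambda>i. F i x) \<longlonglongrightarrow> f x"
    using bcontfun_approx_LIPb[OF f] by metis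
  note Fb = LIPb_bcontfun[OF F(1)]
  \<comment> \<open>The approximant carries the sharp mass, and the crude bound by
    \<open>\<nu>\<close> is spent only on the difference, which vanishes in the limit.\<close>
  have le: "\<bar>L (dform f \<pi>s)\<bar> \<le> prod_Lip k \<pi>s * (\<integral>x. \<bar>F i x\<bar> \<partial>?\<mu>) + C \<pi>s * (\<integral>x. \<bar>f x - F i x\<bar> \<partial>\<nu>)" for i
  proof -
    have "\<bar>T (F i) \<pi>s\<bar> \<le> prod_Lip k \<pi>s * (\<integral>x. \<bar>F i x\<bar> \<partial>?\<mu>)"
      using mb F(1) \<pi>s unfolding mass_bound_prod_Lip by blast
    moreover have "\<bar>L (dform f \<pi>s) - T (F i) \<pi>s\<bar> \<le> C \<pi>s * (\<integral>x. \<bar>f x - F i x\<bar> \<partial>\<nu>)"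
      using bound[OF bcontfun_minus_real[OF f Fb] \<pi>s] linear_dform_diff[OF L f Fb LIP] eq[OF F(1) \<pi>s]
      by simp
    ultimately show ?thesis by linarith
  qed
  have "(\<lambda>i. \<integral>x. \<bar>F i x\<bar> \<partial>?\<mu>) \<longlonglongrightarrow> (\<integral>x. \<bar>f x\<bar> \<partial>?\<mu>)"
  proof (rule integral_bcontfun_tendsto)
    show "(\<lambda>x. \<bar>f x\<bar>) \<in> borel_measurable borel" "(\<lambda>x. \<bar>F i x\<bar>) \<in> borel_measurable borel" for i
      using f Fb by (auto intro!: bcontfun_measurable bcontfun_abs_real)
    show "\<bar>\<bar>F i x\<bar>\<bar> \<le> B" for i x using F(2) by simp
  qed (use mb F(3) in \<open>auto simp: mass_bound_def intro!: tendsto_rabs\<close>)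
  then have "(\<lambda>i. prod_Lip k \<pi>s * (\<integral>x. \<bar>F i x\<bar> \<partial>?\<mu>) + C \<pi>s * (\<integral>x. \<bar>f x - F i x\<bar> \<partial>\<nu>)) \<longlonglongrightarrow>
      prod_Lip k \<pi>s * (\<integral>x. \<bar>f x\<bar> \<partial>?\<mu>) + C \<pi>s * 0"
    by (intro tendsto_intros integral_approx_diff_tendsto[OF \<nu> f F])
  then have "\<bar>L (dform f \<pi>s)\<bar> \<le> prod_Lip k \<pi>s * (\<integral>x. \<bar>f x\<bar> \<partial>?\<mu>) + C \<pi>s * 0"
    by (rule LIMSEQ_le_const) (use le in auto)
  then show "\<bar>L (dform f \<pi>s)\<bar> \<le> (\<Prod>j<k. Lip (\<pi>s ! j)) * (\<integral>x. \<bar>f x\<bar> \<partial>?\<mu>)"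
    by (simp add: prod_Lip_def)
qed (rule eq)

lemma acts_as_bound:
  assumes "acts_as k T L" "f \<in> bcontfun" "\<pi>s \<in> LIP_tuples k"
  shows "\<bar>L (dform f \<pi>s)\<bar> \<le> prod_Lip k \<pi>s * (\<integral>x. \<bar>f x\<bar> \<partial>AK_mass k T)"
  using assms unfolding acts_as_def prod_Lip_def by blast

text \<open>This is the mass inequality for the coefficient f - F. The tuple enters the error only
  through \<open>prod_Lip\<close>, so the error is uniform over tuples with bounded Lipschitz
  constants.\<close>

lemma acts_as_approx:
  fixes T :: "('a::metric_space \<Rightarrow> real) \<Rightarrow> ('a \<Rightarrow> real) list \<Rightarrow> real"
  assumes L: "acts_as k T L" and f: "f \<in> bcontfun" and F: "F \<in> LIPb" and \<pi>s: "\<pi>s \<in> LIP_tuples k"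
  shows "\<bar>L (dform f \<pi>s) - T F \<pi>s\<bar> \<le> prod_Lip k \<pi>s * (\<integral>x. \<bar>f x - F x\<bar> \<partial>AK_mass k T)"
proof -
  have lin: "linear L" and "L (dform F \<pi>s) = T F \<pi>s"
    using L F \<pi>s unfolding acts_as_def by blast+
  moreover have "set \<pi>s \<subseteq> LIP" using \<pi>s by (simp add: LIP_tuples_def)
  ultimately show ?thesis
    using acts_as_bound[OF L bcontfun_minus_real[OF f LIPb_bcontfun[OF F]] \<pi>s]
      linear_dform_diff[OF lin f LIPb_bcontfun[OF F]] by simp
qed

text \<open>The continuity axiom covers Lipschitz coefficients only. An e/3 argument transfers it:
  one Lipschitz approximant of \<open>f\<close> works for all tuples of an equi-Lipschitz
  sequence.\<close>

lemma acts_as_continuous: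
  fixes T :: "('a::polish_space \<Rightarrow> real) \<Rightarrow> ('a \<Rightarrow> real) list \<Rightarrow> real"
  assumes T: "current k T" and L: "acts_as k T L" and f: "f \<in> bcontfun" and \<pi>s: "\<pi>s \<in> LIP_tuples k"
    and p: "\<And>i::nat. p i \<in> LIP_tuples k"
    and lip: "\<And>j. j < k \<Longrightarrow> \<exists>K. \<forall>i. K-lipschitz_on UNIV (p i ! j)"
    and lim: "\<And>j x. j < k \<Longrightarrow> (\<lambda>i. (p i ! j) x) \<longlonglongrightarrow> (\<pi>s ! j) x"
  shows "(\<lambda>i. L (dform f (p i))) \<longlonglongrightarrow> L (dform f \<pi>s)"
proof (rule LIMSEQ_I)
  fix e :: real assume e: "0 < e"
  let ?\<mu> = "AK_mass k T"
  have \<mu>: "finite_measure ?\<mu>" "sets ?\<mu> = sets borel"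
    using current_mass_bound[OF T] by (auto simp: mass_bound_def)
  obtain K where K: "\<And>j i. j < k \<Longrightarrow> (K j)-lipschitz_on UNIV (p i ! j)" using lip by metis
  \<comment> \<open>The product of the \<open>K j\<close> covers all \<open>p i\<close>; the second
    summand covers \<open>\<pi>s\<close> without passing Lipschitz constants to the limit.\<close>
  define C where "C = (\<Prod>j<k. K j) + prod_Lip k \<pi>s"
  have K0: "0 \<le> (\<Prod>j<k. K j)" using lipschitz_on_nonneg[OF K] by (intro prod_nonneg) auto
  have "prod_Lip k (p i) \<le> (\<Prod>j<k. K j)" for i
    unfolding prod_Lip_def
  proof (rule prod_mono)
    fix j assume "j \<in> {..<k}"
    then show "0 \<le> Lip (p i ! j) \<and> Lip (p i ! j) \<le> K j"
      using p[of i] K[of j i] by (auto simp: LIP_tuples_def intro!: Lip_nonneg Lip_le)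
  qed
  then have C: "prod_Lip k (p i) \<le> C" "prod_Lip k \<pi>s \<le> C" for i
    using K0 prod_Lip_nonneg[OF \<pi>s] by (auto simp: C_def add_increasing2)
  have "0 \<le> C" using C(2) prod_Lip_nonneg[OF \<pi>s] by linarith
  obtain F B where F: "\<And>i::nat. F i \<in> LIPb" "\<And>i x. \<bar>F i x\<bar> \<le> B" "\<And>x. (\<lambda>i. F i x) \<longlonglongrightarrow> f x"
    using bcontfun_approx_LIPb[OF f] by metis
  have "(\<lambda>i. C * (\<integral>x. \<bar>f x - F i x\<bar> \<partial>?\<mu>)) \<longlonglongrightarrow> C * 0"
    by (intro tendsto_intros integral_approx_diff_tendsto[OF \<mu> f F])
  then have "\<forall>\<^sub>F i in sequentially. C * (\<integral>x. \<bar>f x - F i x\<bar> \<partial>?\<mu>) < e / 3"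
    using e by (intro order_tendstoD) auto
  then obtain l where l: "C * (\<integral>x. \<bar>f x - F l x\<bar> \<partial>?\<mu>) < e / 3"
    by (auto simp: eventually_sequentially)
  \<comment> \<open>The index \<open>l\<close> was fixed with the common constant \<open>C\<close>,
    so it serves the limit tuple and every \<open>p i\<close> at once.\<close>
  have near: "\<bar>L (dform f \<rho>s) - T (F l) \<rho>s\<bar> < e / 3" if "\<rho>s \<in> LIP_tuples k" "prod_Lip k \<rho>s \<le> C" for \<rho>s
  proof -
    have "prod_Lip k \<rho>s * (\<integral>x. \<bar>f x - F l x\<bar> \<partial>?\<mu>) \<le> C * (\<integral>x. \<bar>f x - F l x\<bar> \<partial>?\<mu>)"
      using that by (intro mult_right_mono integral_nonneg) auto
    then show ?thesis using acts_as_approx[OF L f F(1) that(1), of l] l by linarith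
  qed
  have "(\<lambda>i. T (F l) (p i)) \<longlonglongrightarrow> T (F l) \<pi>s"
    by (rule currentD(4)[OF T F(1) \<pi>s p lip lim])
  then obtain N where N: "\<And>i. N \<le> i \<Longrightarrow> \<bar>T (F l) (p i) - T (F l) \<pi>s\<bar> < e / 3"
    using LIMSEQ_D[of _ _ "e / 3"] e by (metis divide_pos_pos real_norm_def zero_less_numeral)
  have "norm (L (dform f (p i)) - L (dform f \<pi>s)) < e" if "N \<le> i" for i
    using near[OF p C(1), of i] near[OF \<pi>s C(2)] N[OF that] unfolding real_norm_def by linarith
  then show "\<exists>N. \<forall>i\<ge>N. norm (L (dform f (p i)) - L (dform f \<pi>s)) < e" by blast
qed

text \<open>Only the factor \<open>g\<close> is approximated. The products f * G i are Lipschitz and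
  still vanish wherever \<open>f\<close> does, so the locality axiom applies to them; approximants
  of the whole product need not respect its zero set.\<close>

lemma acts_as_local:
  fixes T :: "('a::polish_space \<Rightarrow> real) \<Rightarrow> ('a \<Rightarrow> real) list \<Rightarrow> real"
  assumes T: "current k T" and L: "acts_as k T L" and f: "f \<in> LIPb" and g: "g \<in> bcontfun"
    and \<pi>s: "\<pi>s \<in> LIP_tuples k"
    and loc: "j < k" "open U" "{x. f x \<noteq> 0} \<subseteq> U" "\<And>x. x \<in> U \<Longrightarrow> (\<pi>s ! j) x = c"
  shows "L (dform (\<lambda>x. f x * g x) \<pi>s) = 0"
proof -
  let ?\<mu> = "AK_mass k T"
  have \<mu>: "finite_measure ?\<mu>" "sets ?\<mu> = sets borel"
    using current_mass_bound[OF T] by (auto simp: mass_bound_def)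
  obtain G B where G: "\<And>i::nat. G i \<in> LIPb" "\<And>i x. \<bar>G i x\<bar> \<le> B" "\<And>x. (\<lambda>i. G i x) \<longlonglongrightarrow> g x"
    using bcontfun_approx_LIPb[OF g] by metis
  obtain A where A: "0 \<le> A" "\<And>x. \<bar>f x\<bar> \<le> A" using bcontfun_boundE[OF LIPb_bcontfun[OF f]] by metis
  have fg: "(\<lambda>x. f x * g x) \<in> bcontfun" by (intro bcontfun_mult_real g LIPb_bcontfun f)
  have "\<bar>L (dform (\<lambda>x. f x * g x) \<pi>s)\<bar> \<le> prod_Lip k \<pi>s * (\<integral>x. \<bar>f x * g x - f x * G i x\<bar> \<partial>?\<mu>)" for i
  proof -
    have "{x. f x * G i x \<noteq> 0} \<subseteq> U" using loc(3) by auto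
    then have "T (\<lambda>x. f x * G i x) \<pi>s = 0"
      using loc by (intro currentD(5)[OF T LIPb_mult[OF f G(1)] \<pi>s])
    then show ?thesis using acts_as_approx[OF L fg LIPb_mult[OF f G(1)] \<pi>s, of i] by simp
  qed
  moreover have "(\<lambda>i. prod_Lip k \<pi>s * (\<integral>x. \<bar>f x * g x - f x * G i x\<bar> \<partial>?\<mu>)) \<longlonglongrightarrow> prod_Lip k \<pi>s * 0"
  proof (intro tendsto_mult tendsto_const integral_approx_diff_tendsto[OF \<mu> fg])
    show "(\<lambda>x. f x * G i x) \<in> LIPb" for i by (intro LIPb_mult f G)
    show "\<bar>f x * G i x\<bar> \<le> A * B" for i x unfolding abs_mult by (intro mult_mono A G) auto
  qed (intro tendsto_intros G)
  ultimately have "\<bar>L (dform (\<lambda>x. f x * g x) \<pi>s)\<bar> \<le> prod_Lip k \<pi>s * 0"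
    by (intro LIMSEQ_le_const) auto
  then show ?thesis by simp
qed

text \<open>Common entrance for the two contractions and the zero current. The mass inequality is
  asked for all bounded continuous coefficients, which makes \<open>M\<close> its own extension; the
  other axioms are asked for Lipschitz coefficients.\<close>

lemma current_of_linear:
  fixes M :: "'a::polish_space tensor \<Rightarrow> real"
  assumes k: "1 \<le> k" and M: "linear M" and \<nu>: "finite_measure \<nu>" "sets \<nu> = sets borel"
    and bound: "\<And>f \<pi>s. f \<in> bcontfun \<Longrightarrow> \<pi>s \<in> LIP_tuples k \<Longrightarrow>
      \<bar>M (dform f \<pi>s)\<bar> \<le> prod_Lip k \<pi>s * (\<integral>x. \<bar>f x\<bar> \<partial>\<nu>)"
    and cont: "\<And>f \<pi>s p. f \<in> LIPb \<Longrightarrow> \<pi>s \<in> LIP_tuples k \<Longrightarrow> (\<And>i::nat. p i \<in> LIP_tuples k) \<Longrightarrow>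
      (\<And>j. j < k \<Longrightarrow> \<exists>K. \<forall>i. K-lipschitz_on UNIV (p i ! j)) \<Longrightarrow>
      (\<And>j x. j < k \<Longrightarrow> (\<lambda>i. (p i ! j) x) \<longlonglongrightarrow> (\<pi>s ! j) x) \<Longrightarrow>
      (\<lambda>i. M (dform f (p i))) \<longlonglongrightarrow> M (dform f \<pi>s)"
    and local: "\<And>f \<pi>s j U c. f \<in> LIPb \<Longrightarrow> \<pi>s \<in> LIP_tuples k \<Longrightarrow> j < k \<Longrightarrow> open U \<Longrightarrow>
      {x. f x \<noteq> 0} \<subseteq> U \<Longrightarrow> (\<And>x. x \<in> U \<Longrightarrow> (\<pi>s ! j) x = c) \<Longrightarrow> M (dform f \<pi>s) = 0"
  shows "mass_bound k (\<lambda>f \<pi>s. M (dform f \<pi>s)) \<nu>"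
    and "current k (\<lambda>f \<pi>s. M (dform f \<pi>s))"
    and "acts_as k (\<lambda>f \<pi>s. M (dform f \<pi>s)) M"
proof -
  show mb: "mass_bound k (\<lambda>f \<pi>s. M (dform f \<pi>s)) \<nu>"
    unfolding mass_bound_prod_Lip using \<nu> bound by (auto intro: LIPb_bcontfun)
  show cur: "current k (\<lambda>f \<pi>s. M (dform f \<pi>s))"
    unfolding current_def
  proof (intro conjI ballI allI impI)
    fix f :: "'a \<Rightarrow> real" and \<pi>s :: "('a \<Rightarrow> real) list" and p :: "nat \<Rightarrow> ('a \<Rightarrow> real) list"
    assume "f \<in> LIPb" "\<pi>s \<in> LIP_tuples k" "\<forall>i. p i \<in> LIP_tuples k"
      "\<forall>j<k. \<exists>L. \<forall>i. L-lipschitz_on UNIV (p i ! j)"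
      "\<forall>j<k. \<forall>x. (\<lambda>i. (p i ! j) x) \<longlonglongrightarrow> (\<pi>s ! j) x"
    then show "(\<lambda>i. M (dform f (p i))) \<longlonglongrightarrow> M (dform f \<pi>s)" by (intro cont) auto
  next
    fix f :: "'a \<Rightarrow> real" and \<pi>s :: "('a \<Rightarrow> real) list"
    assume "f \<in> LIPb" "\<pi>s \<in> LIP_tuples k"
      "\<exists>j<k. \<exists>U c. open U \<and> {x. f x \<noteq> 0} \<subseteq> U \<and> (\<forall>x\<in>U. (\<pi>s ! j) x = c)"
    then show "M (dform f \<pi>s) = 0" using local by blast
  qed (use k mb multilinear_of_linear[OF M] in auto)
  show "acts_as k (\<lambda>f \<pi>s. M (dform f \<pi>s)) M"
    using cur M HOL.refl \<nu> bound by (rule acts_asI)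
qed

section \<open>The seminorm\<close>

lemma bilinear_linear_left: "bilinear B \<Longrightarrow> linear (\<lambda>u. B u w)"
  and bilinear_linear_right: "bilinear B \<Longrightarrow> linear (B u)"
  by (simp_all add: bilinear_def)

lemma forms_induct [consumes 1, case_names zero add scale dform]:
  assumes "v \<in> forms k"
    and "P 0" "\<And>u w. P u \<Longrightarrow> P w \<Longrightarrow> P (u + w)" "\<And>c u. P u \<Longrightarrow> P (c *\<^sub>R u)"
    and "\<And>f \<pi>s. f \<in> bcontfun \<Longrightarrow> \<pi>s \<in> LIP_tuples k \<Longrightarrow> P (dform f \<pi>s)"
  shows "P v"
  using assms(1) unfolding forms_def
proof (induction rule: span_induct)
  case base
  show ?case using assms(2-4) by (simp add: subspace_def)
next
  case (step x)
  then show ?case using assms(5) by blast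
qed

section \<open>Densities and rescaling of currents\<close>

lemma measure_density_UNIV:
  assumes "sets \<mu> = sets borel" "h \<in> borel_measurable borel" "\<And>x. 0 \<le> h x"
  shows "measure (density \<mu> h) UNIV = (\<integral>x. h x \<partial>\<mu>)"
proof -
  note [measurable_cong] = assms(1)
  note [measurable] = assms(2)
  have "measure (density \<mu> h) UNIV = (\<integral>x. 1 \<partial>density \<mu> h)"
    using assms(1) by (simp add: sets_eq_imp_space_eq)
  also have "\<dots> = (\<integral>x. h x \<partial>\<mu>)"
    using assms(3) by (subst integral_real_density) simp_all
  finally show ?thesis .
qed

lemma finite_measure_density:
  fixes h :: "'a::metric_space \<Rightarrow> real"
  assumes "sets \<mu> = sets borel" "h \<in> borel_measurable borel" "\<And>x. 0 \<le> h x" "integrable \<mu> h"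
  shows "finite_measure (density \<mu> h)"
proof -
  \<comment> \<open>The zero functional is a pretext: \<open>mass_bound\<close> contains finiteness
    of its measure, so the criterion for densities delivers it.\<close>
  have "mass_bound 0 (\<lambda>(f :: 'a \<Rightarrow> real) \<pi>s. 0) (density \<mu> h)"
    unfolding mass_bound_density[OF assms]
    by (auto intro!: mult_nonneg_nonneg prod_Lip_nonneg Bochner_Integration.integral_nonneg assms(3))
  then show ?thesis by (simp add: mass_bound_def)
qed

lemma AK_mass_le:
  fixes T :: "('a::polish_space \<Rightarrow> real) \<Rightarrow> ('a \<Rightarrow> real) list \<Rightarrow> real"
  assumes T: "current k T" and \<mu>: "mass_bound k T \<mu>"
  shows "measure (AK_mass k T) UNIV \<le> measure \<mu> UNIV"
proof -
  interpret m: finite_measure \<mu> using \<mu> by (simp add: mass_bound_def)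
  interpret a: finite_measure "AK_mass k T"
    using current_mass_bound[OF T] by (simp add: mass_bound_def)
  show ?thesis
    using AK_mass_minimal(2)[OF currentD(2)[OF T] \<mu>, of UNIV]
    by (simp add: m.emeasure_eq_measure a.emeasure_eq_measure)
qed

lemma mass_bound_cmult:
  fixes T :: "('a::metric_space \<Rightarrow> real) \<Rightarrow> ('a \<Rightarrow> real) list \<Rightarrow> real"
  assumes \<mu>: "mass_bound k T \<mu>"
  shows "mass_bound k (\<lambda>f \<pi>s. c * T f \<pi>s) (density \<mu> (\<lambda>_. \<bar>c\<bar>))"
proof -
  have s: "finite_measure \<mu>" "sets \<mu> = sets borel" using \<mu> by (auto simp: mass_bound_def)
  interpret finite_measure \<mu> by fact
  have "\<bar>c * T f \<pi>s\<bar> \<le> prod_Lip k \<pi>s * (\<integral>x. \<bar>c\<bar> * \<bar>f x\<bar> \<partial>\<mu>)"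
    if "f \<in> LIPb" "\<pi>s \<in> LIP_tuples k" for f \<pi>s
  proof -
    have "\<bar>c\<bar> * \<bar>T f \<pi>s\<bar> \<le> \<bar>c\<bar> * (prod_Lip k \<pi>s * (\<integral>x. \<bar>f x\<bar> \<partial>\<mu>))"
      using \<mu> that by (intro mult_left_mono) (auto simp: mass_bound_prod_Lip)
    then show ?thesis by (simp add: abs_mult mult.left_commute)
  qed
  then show ?thesis by (subst mass_bound_density) (simp_all add: s)
qed

lemma current_cmult:
  fixes T :: "('a::metric_space \<Rightarrow> real) \<Rightarrow> ('a \<Rightarrow> real) list \<Rightarrow> real"
  assumes T: "current k T"
  shows "current k (\<lambda>f \<pi>s. c * T f \<pi>s)"
  unfolding current_def
proof (intro conjI ballI allI impI)
  show "1 \<le> k" by (rule currentD(1)[OF T])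
  show "multilinear k (\<lambda>f \<pi>s. c * T f \<pi>s)"
    using currentD(2)[OF T] unfolding multilinear_def by (simp add: distrib_left mult.left_commute)
  obtain \<mu> where "mass_bound k T \<mu>" using currentD(3)[OF T] by (rule exE)
  then show "\<exists>\<mu>. mass_bound k (\<lambda>f \<pi>s. c * T f \<pi>s) \<mu>" using mass_bound_cmult by blast
next
  fix f :: "'a \<Rightarrow> real" and \<pi>s :: "('a \<Rightarrow> real) list" and p :: "nat \<Rightarrow> ('a \<Rightarrow> real) list"
  assume "f \<in> LIPb" "\<pi>s \<in> LIP_tuples k" "\<forall>i. p i \<in> LIP_tuples k"
    "\<forall>j<k. \<exists>L. \<forall>i. L-lipschitz_on UNIV (p i ! j)"
    "\<forall>j<k. \<forall>x. (\<lambda>i. (p i ! j) x) \<longlonglongrightarrow> (\<pi>s ! j) x"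
  then show "(\<lambda>i. c * T f (p i)) \<longlonglongrightarrow> c * T f \<pi>s"
    by (intro tendsto_mult tendsto_const currentD(4)[OF T]) auto
next
  fix f :: "'a \<Rightarrow> real" and \<pi>s :: "('a \<Rightarrow> real) list"
  assume f: "f \<in> LIPb" "\<pi>s \<in> LIP_tuples k"
    and "\<exists>j<k. \<exists>U c. open U \<and> {x. f x \<noteq> 0} \<subseteq> U \<and> (\<forall>x\<in>U. (\<pi>s ! j) x = c)"
  then obtain j U d where "j < k" "open U" "{x. f x \<noteq> 0} \<subseteq> U" "\<forall>x\<in>U. (\<pi>s ! j) x = d" by blast
  then have "T f \<pi>s = 0" by (intro currentD(5)[OF T f]) auto
  then show "c * T f \<pi>s = 0" by simp
qed

text \<open>The mass of the multiple is never computed: a crude bound by |c| times the old mass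
  suffices, since \<open>acts_asI\<close> sharpens it automatically.\<close>

lemma acts_as_cmult:
  fixes T :: "('a::polish_space \<Rightarrow> real) \<Rightarrow> ('a \<Rightarrow> real) list \<Rightarrow> real"
  assumes T: "current k T" and L: "acts_as k T L"
  shows "acts_as k (\<lambda>f \<pi>s. c * T f \<pi>s) (\<lambda>v. c * L v)"
proof (rule acts_asI[OF current_cmult[OF T], where C = "\<lambda>\<pi>s. \<bar>c\<bar> * prod_Lip k \<pi>s" and \<nu> = "AK_mass k T"])
  have lin: "linear L" using L by (simp add: acts_as_def)
  show "linear (\<lambda>v. c * L v)"
    by (rule linearI) (simp_all add: linear_add[OF lin] linear_cmul[OF lin] distrib_left)
  show "c * L (dform f \<pi>s) = c * T f \<pi>s" if "f \<in> LIPb" "\<pi>s \<in> LIP_tuples k" for f \<pi>s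
    using L that by (simp add: acts_as_def)
  show "finite_measure (AK_mass k T)" "sets (AK_mass k T) = sets borel"
    using current_mass_bound[OF T] by (auto simp: mass_bound_def)
  show "\<bar>c * L (dform f \<pi>s)\<bar> \<le> \<bar>c\<bar> * prod_Lip k \<pi>s * (\<integral>x. \<bar>f x\<bar> \<partial>AK_mass k T)"
    if "f \<in> bcontfun" "\<pi>s \<in> LIP_tuples k" for f \<pi>s
    using acts_as_bound[OF L that] by (simp add: abs_mult mult.assoc mult_left_mono)
qed

text \<open>A real supremum says something only about a set bounded above. On a generator, mass at
  most 1 bounds the integral of |f| by a sup bound of f; sums and multiples follow by
  linearity.\<close>

lemma acts_as_bounded:
  fixes v :: "'a::polish_space tensor"
  assumes "v \<in> forms k"
  shows "\<exists>C. \<forall>T L. current k T \<longrightarrow> measure (AK_mass k T) UNIV \<le> 1 \<longrightarrow> acts_as k T L \<longrightarrow> \<bar>L v\<bar> \<le> C"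
  using assms
proof (induction rule: forms_induct)
  case zero
  show ?case by (rule exI[of _ 0]) (simp add: acts_as_def linear_0)
next
  case (add u w)
  obtain C where C: "\<forall>T L. current k T \<longrightarrow> measure (AK_mass k T) UNIV \<le> 1 \<longrightarrow> acts_as k T L \<longrightarrow> \<bar>L u\<bar> \<le> C"
    using add(1) by (rule exE)
  obtain D where D: "\<forall>T L. current k T \<longrightarrow> measure (AK_mass k T) UNIV \<le> 1 \<longrightarrow> acts_as k T L \<longrightarrow> \<bar>L w\<bar> \<le> D"
    using add(2) by (rule exE)
  show ?case
  proof (intro exI[of _ "C + D"] allI impI)
    fix T and L :: "'a tensor \<Rightarrow> real"
    assume *: "current k T" "measure (AK_mass k T) UNIV \<le> 1" "acts_as k T L"
    then have "linear L" by (simp add: acts_as_def)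
    then show "\<bar>L (u + w)\<bar> \<le> C + D"
      using C[rule_format, OF *] D[rule_format, OF *] by (simp add: linear_add)
  qed
next
  case (scale c u)
  obtain C where C: "\<forall>T L. current k T \<longrightarrow> measure (AK_mass k T) UNIV \<le> 1 \<longrightarrow> acts_as k T L \<longrightarrow> \<bar>L u\<bar> \<le> C"
    using scale by (rule exE)
  show ?case
  proof (intro exI[of _ "\<bar>c\<bar> * C"] allI impI)
    fix T and L :: "'a tensor \<Rightarrow> real"
    assume *: "current k T" "measure (AK_mass k T) UNIV \<le> 1" "acts_as k T L"
    then have "linear L" by (simp add: acts_as_def)
    then show "\<bar>L (c *\<^sub>R u)\<bar> \<le> \<bar>c\<bar> * C"
      using C[rule_format, OF *] by (simp add: linear_cmul abs_mult mult_left_mono)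
  qed
next
  case (dform f \<pi>s)
  obtain B where B: "0 \<le> B" "\<And>x. \<bar>f x\<bar> \<le> B" using bcontfun_boundE[OF dform(1)] by metis
  show ?case
  proof (intro exI[of _ "prod_Lip k \<pi>s * B"] allI impI)
    fix T and L :: "'a tensor \<Rightarrow> real"
    assume T: "current k T" and m: "measure (AK_mass k T) UNIV \<le> 1" and L: "acts_as k T L"
    have s: "finite_measure (AK_mass k T)" "sets (AK_mass k T) = sets borel"
      using current_mass_bound[OF T] by (auto simp: mass_bound_def)
    interpret finite_measure "AK_mass k T" by fact
    have "(\<integral>x. \<bar>f x\<bar> \<partial>AK_mass k T) \<le> (\<integral>x. B \<partial>AK_mass k T)"
      by (intro integral_mono bcontfun_integrable s bcontfun_abs_real dform(1)) (simp_all add: B)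
    also have "\<dots> = measure (AK_mass k T) UNIV * B"
      using s(2) by (simp add: sets_eq_imp_space_eq)
    also have "\<dots> \<le> 1 * B"
      by (intro mult_right_mono m B)
    finally have "prod_Lip k \<pi>s * (\<integral>x. \<bar>f x\<bar> \<partial>AK_mass k T) \<le> prod_Lip k \<pi>s * B"
      by (intro mult_left_mono prod_Lip_nonneg dform(2)) simp
    then show "\<bar>L (dform f \<pi>s)\<bar> \<le> prod_Lip k \<pi>s * B"
      using acts_as_bound[OF L dform] by linarith
  qed
qed

lemma acts_as_le_seminorm:
  fixes v :: "'a::polish_space tensor"
  assumes "v \<in> forms k" "current k T" "measure (AK_mass k T) UNIV \<le> 1" "acts_as k T L"
  shows "L v \<le> seminorm k v"
  unfolding seminorm_def
proof (rule cSup_upper)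
  obtain C where C: "\<forall>T L. current k T \<longrightarrow> measure (AK_mass k T) UNIV \<le> 1 \<longrightarrow> acts_as k T L \<longrightarrow> \<bar>L v\<bar> \<le> C"
    using acts_as_bounded[OF assms(1)] by (rule exE)
  show "bdd_above {L v |T L. current k T \<and> measure (AK_mass k T) UNIV \<le> 1 \<and> acts_as k T L}"
  proof (rule bdd_aboveI[of _ C])
    fix y assume "y \<in> {L v |T L. current k T \<and> measure (AK_mass k T) UNIV \<le> 1 \<and> acts_as k T L}"
    then obtain T L where y: "y = L v"
      and "current k T" "measure (AK_mass k T) UNIV \<le> 1" "acts_as k T L"
      by (elim CollectE exE conjE)
    from C[rule_format, OF this(2-4)] show "y \<le> C" by (simp add: y)
  qed
  show "L v \<in> {L v |T L. current k T \<and> measure (AK_mass k T) UNIV \<le> 1 \<and> acts_as k T L}"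
    using assms(2-4) by (intro CollectI exI[of _ T] exI[of _ L] conjI HOL.refl)
qed

text \<open>It contributes the value 0 to the set under the supremum, which makes that set nonempty
  and the seminorm nonnegative.\<close>

lemma zero_current:
  assumes "1 \<le> k"
  shows "current k (\<lambda>(f :: 'a::polish_space \<Rightarrow> real) \<pi>s. 0)"
    and "measure (AK_mass k (\<lambda>(f :: 'a \<Rightarrow> real) \<pi>s. 0)) UNIV \<le> 1"
    and "acts_as k (\<lambda>(f :: 'a \<Rightarrow> real) \<pi>s. 0) (\<lambda>v. 0)"
proof -
  let ?M = "\<lambda>v :: 'a tensor. 0 :: real"
  have lin: "linear ?M" by (rule linearI) auto
  have fin: "finite_measure (null_measure borel :: 'a measure)" by (intro finite_measureI) simp
  have s: "sets (null_measure borel :: 'a measure) = sets borel" by simp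
  note * = current_of_linear[OF assms lin fin s]
  show cur: "current k (\<lambda>(f :: 'a \<Rightarrow> real) \<pi>s. 0)" and "acts_as k (\<lambda>(f :: 'a \<Rightarrow> real) \<pi>s. 0) (\<lambda>v. 0)"
    by (rule *; simp)+
  have "mass_bound k (\<lambda>(f :: 'a \<Rightarrow> real) \<pi>s. 0) (null_measure borel)" by (rule *; simp)
  from AK_mass_le[OF cur this]
  show "measure (AK_mass k (\<lambda>(f :: 'a \<Rightarrow> real) \<pi>s. 0)) UNIV \<le> 1" by simp
qed

lemma seminorm_nonneg:
  fixes v :: "'a::polish_space tensor"
  assumes "1 \<le> k" "v \<in> forms k"
  shows "0 \<le> seminorm k v"
  using acts_as_le_seminorm[OF assms(2) zero_current[OF assms(1)]] .

text \<open>Homogeneity: a multiple of \<open>T\<close> by a small enough factor is admissible in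
  the supremum. Any bound \<open>\<mu>\<close> is allowed because the mass of a contraction is only
  known from above.\<close>

lemma acts_as_le_seminorm_mass:
  fixes v :: "'a::polish_space tensor"
  assumes v: "v \<in> forms k" and T: "current k T" and L: "acts_as k T L" and \<mu>: "mass_bound k T \<mu>"
  shows "\<bar>L v\<bar> \<le> seminorm k v * measure \<mu> UNIV"
proof -
  have s: "finite_measure \<mu>" "sets \<mu> = sets borel" using \<mu> by (auto simp: mass_bound_def)
  have scaled: "c * L v \<le> seminorm k v" if c: "\<bar>c\<bar> * measure \<mu> UNIV \<le> 1" for c
  proof (rule acts_as_le_seminorm[OF v current_cmult[OF T] _ acts_as_cmult[OF T L]])
    have "measure (density \<mu> (\<lambda>_. \<bar>c\<bar>)) UNIV = \<bar>c\<bar> * measure \<mu> UNIV"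
      using s by (subst measure_density_UNIV) (simp_all add: sets_eq_imp_space_eq)
    then show "measure (AK_mass k (\<lambda>f \<pi>s. c * T f \<pi>s)) UNIV \<le> 1"
      using AK_mass_le[OF current_cmult[OF T] mass_bound_cmult[OF \<mu>], of c] c by simp
  qed
  have le: "\<bar>L v\<bar> \<le> seminorm k v * (measure \<mu> UNIV + inverse (real (Suc i)))" for i
  proof -
    \<comment> \<open>The extra summand keeps \<open>t\<close> positive even when
      \<open>\<mu>\<close> is zero; it disappears in the limit. Scaling by 1/t and by -1/t yields
      the absolute value.\<close>
    define t where "t = measure \<mu> UNIV + inverse (real (Suc i))"
    have t: "0 < t" "measure \<mu> UNIV \<le> t" by (auto simp: t_def add_nonneg_pos)
    then have "\<bar>1 / t\<bar> * measure \<mu> UNIV \<le> 1" "\<bar>- 1 / t\<bar> * measure \<mu> UNIV \<le> 1" by simp_all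
    from scaled[OF this(1)] scaled[OF this(2)] have "\<bar>L v\<bar> / t \<le> seminorm k v" by (auto simp: abs_if)
    then show ?thesis using t(1) by (simp add: pos_divide_le_eq t_def)
  qed
  have "(\<lambda>i. seminorm k v * (measure \<mu> UNIV + inverse (real (Suc i)))) \<longlonglongrightarrow>
      seminorm k v * (measure \<mu> UNIV + 0)"
    by (intro tendsto_intros LIMSEQ_inverse_real_of_nat)
  then have "\<bar>L v\<bar> \<le> seminorm k v * (measure \<mu> UNIV + 0)"
    by (rule LIMSEQ_le_const) (use le in auto)
  then show ?thesis by simp
qed

section \<open>Contraction of a current with a form\<close>

lemma LIP_tuples_append:
  "\<pi>s \<in> LIP_tuples n \<Longrightarrow> \<rho>s \<in> LIP_tuples m \<Longrightarrow> \<pi>s @ \<rho>s \<in> LIP_tuples (n + m)"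
  by (auto simp: LIP_tuples_def)

lemma prod_Lip_append:
  assumes "\<pi>s \<in> LIP_tuples n" "\<rho>s \<in> LIP_tuples m"
  shows "prod_Lip (n + m) (\<pi>s @ \<rho>s) = prod_Lip n \<pi>s * prod_Lip m \<rho>s"
proof -
  have l: "length \<pi>s = n" "length \<rho>s = m" using assms by (auto simp: LIP_tuples_def)
  have "prod_Lip (length xs) xs = prod_list (map Lip xs)" for xs :: "('a \<Rightarrow> real) list"
    unfolding prod_Lip_def by (simp add: prod.list_conv_set_nth lessThan_atLeast0)
  from this[of "\<pi>s @ \<rho>s"] this[of \<pi>s] this[of \<rho>s] show ?thesis by (simp add: l)
qed

lemma LIP_tuples_nth_lipschitz:
  assumes "\<pi>s \<in> LIP_tuples n" "j < n"
  shows "\<exists>K. K-lipschitz_on UNIV (\<pi>s ! j)"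
proof -
  have "\<pi>s ! j \<in> LIP" using assms by (auto simp: LIP_tuples_def)
  then show ?thesis by (simp add: LIP_def)
qed

context
  fixes n m :: nat and T :: "('a::polish_space \<Rightarrow> real) \<Rightarrow> ('a \<Rightarrow> real) list \<Rightarrow> real"
    and L :: "'a tensor \<Rightarrow> real"
  assumes T: "current (n + m) T" and L: "acts_as (n + m) T L"
begin

lemma linear_acts_as: "linear L"
  using L by (simp add: acts_as_def)

lemma finite_AK_mass: "finite_measure (AK_mass (n + m) T)" "sets (AK_mass (n + m) T) = sets borel"
  using current_mass_bound[OF T] by (auto simp: mass_bound_def)

text \<open>Everything depending on \<open>f\<close> and \<open>\<pi>s\<close> stands next to the
  measure, where it becomes the density of a mass bound for the inner contraction.\<close>

lemma wedge_dform_bound: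
  assumes f: "f \<in> bcontfun" and \<pi>s: "\<pi>s \<in> LIP_tuples n" and g: "g \<in> bcontfun" and \<rho>s: "\<rho>s \<in> LIP_tuples m"
  shows "\<bar>L (wedge (dform f \<pi>s) (dform g \<rho>s))\<bar> \<le>
    prod_Lip m \<rho>s * (\<integral>x. prod_Lip n \<pi>s * \<bar>f x\<bar> * \<bar>g x\<bar> \<partial>AK_mass (n + m) T)"
proof -
  have w: "wedge (dform f \<pi>s) (dform g \<rho>s) = dform (\<lambda>x. f x * g x) (\<pi>s @ \<rho>s)"
    using f g \<pi>s \<rho>s by (intro wedge_dform) (auto simp: LIP_tuples_def)
  show ?thesis
    using acts_as_bound[OF L bcontfun_mult_real[OF f g] LIP_tuples_append[OF \<pi>s \<rho>s]]
    by (simp add: w prod_Lip_append[OF \<pi>s \<rho>s] abs_mult mult.assoc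
        mult.left_commute[of "prod_Lip n \<pi>s" "prod_Lip m \<rho>s"])
qed

text \<open>The disjunction serves both contractions: only the factor supported in \<open>U\<close>
  has to be Lipschitz, and it is \<open>g\<close> for the inner one, \<open>f\<close> for the outer
  one.\<close>

lemma wedge_dform_local:
  assumes f: "f \<in> bcontfun" and \<pi>s: "\<pi>s \<in> LIP_tuples n" and g: "g \<in> bcontfun" and \<rho>s: "\<rho>s \<in> LIP_tuples m"
    and loc: "f \<in> LIPb \<and> {x. f x \<noteq> 0} \<subseteq> U \<or> g \<in> LIPb \<and> {x. g x \<noteq> 0} \<subseteq> U"
    and U: "j < n + m" "open U" "\<And>x. x \<in> U \<Longrightarrow> ((\<pi>s @ \<rho>s) ! j) x = c"
  shows "L (wedge (dform f \<pi>s) (dform g \<rho>s)) = 0"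
proof -
  note \<sigma>s = LIP_tuples_append[OF \<pi>s \<rho>s]
  have w: "wedge (dform f \<pi>s) (dform g \<rho>s) = dform (\<lambda>x. f x * g x) (\<pi>s @ \<rho>s)"
    using f g \<pi>s \<rho>s by (intro wedge_dform) (auto simp: LIP_tuples_def)
  from loc show ?thesis
  proof
    assume "f \<in> LIPb \<and> {x. f x \<noteq> 0} \<subseteq> U"
    then show ?thesis unfolding w by (intro acts_as_local[OF T L _ g \<sigma>s U(1,2) _ U(3)]) auto
  next
    assume "g \<in> LIPb \<and> {x. g x \<noteq> 0} \<subseteq> U"
    then have "L (dform (\<lambda>x. g x * f x) (\<pi>s @ \<rho>s)) = 0"
      by (intro acts_as_local[OF T L _ f \<sigma>s U(1,2) _ U(3)]) auto
    then show ?thesis unfolding w by (simp add: mult.commute)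
  qed
qed

text \<open>Both lists may vary; each contraction freezes one of them as a constant
  sequence.\<close>

lemma wedge_dform_continuous:
  assumes f: "f \<in> bcontfun" and \<pi>s: "\<pi>s \<in> LIP_tuples n" and g: "g \<in> bcontfun" and \<rho>s: "\<rho>s \<in> LIP_tuples m"
    and p: "\<And>i::nat. p i \<in> LIP_tuples n" and r: "\<And>i::nat. r i \<in> LIP_tuples m"
    and p': "\<And>j. j < n \<Longrightarrow> \<exists>K. \<forall>i. K-lipschitz_on UNIV (p i ! j)"
      "\<And>j x. j < n \<Longrightarrow> (\<lambda>i. (p i ! j) x) \<longlonglongrightarrow> (\<pi>s ! j) x"
    and r': "\<And>j. j < m \<Longrightarrow> \<exists>K. \<forall>i. K-lipschitz_on UNIV (r i ! j)"
      "\<And>j x. j < m \<Longrightarrow> (\<lambda>i. (r i ! j) x) \<longlonglongrightarrow> (\<rho>s ! j) x"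
  shows "(\<lambda>i. L (wedge (dform f (p i)) (dform g (r i)))) \<longlonglongrightarrow> L (wedge (dform f \<pi>s) (dform g \<rho>s))"
proof -
  have w: "wedge (dform f \<pi>s) (dform g \<rho>s) = dform (\<lambda>x. f x * g x) (\<pi>s @ \<rho>s)"
    if "\<pi>s \<in> LIP_tuples n" "\<rho>s \<in> LIP_tuples m" for \<pi>s \<rho>s
    using f g that by (intro wedge_dform) (auto simp: LIP_tuples_def)
  have nth: "(\<pi>s @ \<rho>s) ! j = (if j < n then \<pi>s ! j else \<rho>s ! (j - n))"
    if "\<pi>s \<in> LIP_tuples n" for \<pi>s \<rho>s :: "('a \<Rightarrow> real) list" and j
    using that by (auto simp: LIP_tuples_def nth_append)
  show ?thesis
    unfolding w[OF \<pi>s \<rho>s] w[OF p r]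
  proof (rule acts_as_continuous[OF T L bcontfun_mult_real[OF f g]])
    fix j assume j: "j < n + m"
    show "\<exists>K. \<forall>i. K-lipschitz_on UNIV ((p i @ r i) ! j)"
      unfolding nth[OF p] using p'(1)[of j] r'(1)[of "j - n"] j by (cases "j < n") auto
    show "(\<lambda>i. ((p i @ r i) ! j) x) \<longlonglongrightarrow> ((\<pi>s @ \<rho>s) ! j) x" for x
      unfolding nth[OF p] nth[OF \<pi>s] using p'(2)[of j x] r'(2)[of "j - n" x] j by (cases "j < n") auto
  qed (intro LIP_tuples_append \<pi>s \<rho>s p r)+
qed

text \<open>Inner contraction: with \<open>f\<close> and \<open>\<pi>s\<close> frozen, the map in
  \<open>u\<close> is an m-current, evaluated at \<open>w\<close>. Here \<open>w\<close> enters only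
  through its seminorm.\<close>

lemma wedge_dform_le:
  assumes m: "1 \<le> m" and f: "f \<in> bcontfun" and \<pi>s: "\<pi>s \<in> LIP_tuples n" and w: "w \<in> forms m"
  shows "\<bar>L (wedge (dform f \<pi>s) w)\<bar> \<le>
    seminorm m w * (prod_Lip n \<pi>s * (\<integral>x. \<bar>f x\<bar> \<partial>AK_mass (n + m) T))"
proof -
  let ?\<mu> = "AK_mass (n + m) T" and ?h = "\<lambda>x. prod_Lip n \<pi>s * \<bar>f x\<bar>"
  let ?M = "\<lambda>u. L (wedge (dform f \<pi>s) u)"
  have lin: "linear ?M"
    using linear_compose[OF bilinear_linear_right[OF bilinear_wedge] linear_acts_as] by (simp add: o_def)
  have h: "?h \<in> bcontfun" by (intro bcontfun_mult_real bcontfun_abs_real f bcontfun_const_real)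
  have h0: "0 \<le> ?h x" for x using prod_Lip_nonneg[OF \<pi>s] by simp
  note hm = bcontfun_measurable[OF h] and hi = bcontfun_integrable[OF h finite_AK_mass]
  have fin: "finite_measure (density ?\<mu> ?h)"
    by (rule finite_measure_density[OF finite_AK_mass(2) hm h0 hi])
  have sets: "sets (density ?\<mu> ?h) = sets borel" by (simp add: finite_AK_mass)
  have bound: "\<bar>?M (dform g \<rho>s)\<bar> \<le> prod_Lip m \<rho>s * (\<integral>x. \<bar>g x\<bar> \<partial>density ?\<mu> ?h)"
    if g: "g \<in> bcontfun" and \<rho>s: "\<rho>s \<in> LIP_tuples m" for g \<rho>s
  proof -
    note [measurable_cong] = finite_AK_mass(2)
    note [measurable] = bcontfun_measurable[OF g] hm
    have "(\<integral>x. \<bar>g x\<bar> \<partial>density ?\<mu> ?h) = (\<integral>x. ?h x * \<bar>g x\<bar> \<partial>?\<mu>)"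
      by (rule integral_real_density) (use h0 in simp_all)
    then show ?thesis using wedge_dform_bound[OF f \<pi>s g \<rho>s] by simp
  qed
  have cont: "(\<lambda>i. ?M (dform g (r i))) \<longlonglongrightarrow> ?M (dform g \<rho>s)"
    if "g \<in> LIPb" "\<rho>s \<in> LIP_tuples m" "\<And>i::nat. r i \<in> LIP_tuples m"
      "\<And>j. j < m \<Longrightarrow> \<exists>K. \<forall>i. K-lipschitz_on UNIV (r i ! j)"
      "\<And>j x. j < m \<Longrightarrow> (\<lambda>i. (r i ! j) x) \<longlonglongrightarrow> (\<rho>s ! j) x" for g \<rho>s r
    using LIP_tuples_nth_lipschitz[OF \<pi>s]
    by (intro wedge_dform_continuous that f \<pi>s LIPb_bcontfun[OF that(1)] tendsto_const) auto
  have loc: "?M (dform g \<rho>s) = 0"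
    if "g \<in> LIPb" and \<rho>s: "\<rho>s \<in> LIP_tuples m" and "j < m" "open U" "{x. g x \<noteq> 0} \<subseteq> U"
      "\<And>x. x \<in> U \<Longrightarrow> (\<rho>s ! j) x = c" for g \<rho>s j U c
  proof (rule wedge_dform_local[OF f \<pi>s LIPb_bcontfun[OF that(1)] \<rho>s])
    \<comment> \<open>Slot \<open>j\<close> of the second list is slot \<open>n + j\<close> of the
      concatenation.\<close>
    show "((\<pi>s @ \<rho>s) ! (n + j)) x = c" if "x \<in> U" for x
      using \<pi>s \<open>\<And>x. x \<in> U \<Longrightarrow> (\<rho>s ! j) x = c\<close>[OF that] by (auto simp: LIP_tuples_def nth_append)
  qed (use that in auto)
  have "mass_bound m (\<lambda>g \<rho>s. ?M (dform g \<rho>s)) (density ?\<mu> ?h)"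
    "current m (\<lambda>g \<rho>s. ?M (dform g \<rho>s))" "acts_as m (\<lambda>g \<rho>s. ?M (dform g \<rho>s)) ?M"
    by (rule current_of_linear[OF m lin fin sets]; fact bound cont loc)+
  from acts_as_le_seminorm_mass[OF w this(2,3,1)]
  have "\<bar>?M w\<bar> \<le> seminorm m w * measure (density ?\<mu> ?h) UNIV" .
  also have "measure (density ?\<mu> ?h) UNIV = (\<integral>x. ?h x \<partial>?\<mu>)"
    by (rule measure_density_UNIV[OF finite_AK_mass(2) hm h0])
  finally show ?thesis by simp
qed

text \<open>Outer contraction: with \<open>w\<close> frozen, the map in \<open>u\<close> is an
  n-current whose mass is at most the seminorm of \<open>w\<close> times that of \<open>T\<close>,
  evaluated at \<open>v\<close>.\<close>

lemma wedge_forms_le: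
  assumes n: "1 \<le> n" and m: "1 \<le> m" and v: "v \<in> forms n" and w: "w \<in> forms m"
  shows "\<bar>L (wedge v w)\<bar> \<le> seminorm n v * (seminorm m w * measure (AK_mass (n + m) T) UNIV)"
proof -
  let ?\<mu> = "AK_mass (n + m) T" and ?h = "\<lambda>x::'a. seminorm m w"
  let ?M = "\<lambda>u. L (wedge u w)"
  interpret finite_measure ?\<mu> by (rule finite_AK_mass)
  have lin: "linear ?M"
    using linear_compose[OF bilinear_linear_left[OF bilinear_wedge] linear_acts_as] by (simp add: o_def)
  have h0: "0 \<le> ?h x" for x using seminorm_nonneg[OF m w] .
  have hm: "?h \<in> borel_measurable borel" and hi: "integrable ?\<mu> ?h" by simp_all
  have fin: "finite_measure (density ?\<mu> ?h)"
    by (rule finite_measure_density[OF finite_AK_mass(2) hm h0 hi])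
  have sets: "sets (density ?\<mu> ?h) = sets borel" by (simp add: finite_AK_mass)
  \<comment> \<open>The inner estimate uses \<open>w\<close> as a whole; summing over generators of
    \<open>w\<close> would give a larger constant.\<close>
  have bound: "\<bar>?M (dform f \<pi>s)\<bar> \<le> prod_Lip n \<pi>s * (\<integral>x. \<bar>f x\<bar> \<partial>density ?\<mu> ?h)"
    if f: "f \<in> bcontfun" and \<pi>s: "\<pi>s \<in> LIP_tuples n" for f \<pi>s
  proof -
    note [measurable_cong] = finite_AK_mass(2)
    note [measurable] = bcontfun_measurable[OF f]
    have "(\<integral>x. \<bar>f x\<bar> \<partial>density ?\<mu> ?h) = (\<integral>x. ?h x * \<bar>f x\<bar> \<partial>?\<mu>)"
      by (rule integral_real_density) (use h0 in simp_all)
    then show ?thesis using wedge_dform_le[OF m f \<pi>s w] by (simp add: mult_ac)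
  qed
  \<comment> \<open>No constant is at stake here, so it is enough to treat generators of
    \<open>w\<close> and pass to linear combinations.\<close>
  have cont: "(\<lambda>i. ?M (dform f (p i))) \<longlonglongrightarrow> ?M (dform f \<pi>s)"
    if f: "f \<in> LIPb" and \<pi>s: "\<pi>s \<in> LIP_tuples n" and p: "\<And>i::nat. p i \<in> LIP_tuples n"
      "\<And>j. j < n \<Longrightarrow> \<exists>K. \<forall>i. K-lipschitz_on UNIV (p i ! j)"
      "\<And>j x. j < n \<Longrightarrow> (\<lambda>i. (p i ! j) x) \<longlonglongrightarrow> (\<pi>s ! j) x" for f \<pi>s p
    using w
  proof (induction rule: forms_induct)
    case zero
    show ?case by (simp add: bilinear_rzero[OF bilinear_wedge])
  next
    case (add u w)
    then show ?case
      by (simp add: bilinear_radd[OF bilinear_wedge] linear_add[OF linear_acts_as] tendsto_add)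
  next
    case (scale c u)
    then show ?case
      by (simp add: bilinear_rmul[OF bilinear_wedge] linear_cmul[OF linear_acts_as] tendsto_mult_left)
  next
    case (dform g \<rho>s)
    then show ?case
      using LIP_tuples_nth_lipschitz[OF dform(2)]
      by (intro wedge_dform_continuous p \<pi>s LIPb_bcontfun[OF f] tendsto_const) auto
  qed
  have loc: "?M (dform f \<pi>s) = 0"
    if f: "f \<in> LIPb" and \<pi>s: "\<pi>s \<in> LIP_tuples n" and U: "j < n" "open U" "{x. f x \<noteq> 0} \<subseteq> U"
      "\<And>x. x \<in> U \<Longrightarrow> (\<pi>s ! j) x = c" for f \<pi>s j U c
    using w
  proof (induction rule: forms_induct)
    case zero
    show ?case by (simp add: bilinear_rzero[OF bilinear_wedge] linear_0[OF linear_acts_as])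
  next
    case (add u w)
    then show ?case by (simp add: bilinear_radd[OF bilinear_wedge] linear_add[OF linear_acts_as])
  next
    case (scale c u)
    then show ?case by (simp add: bilinear_rmul[OF bilinear_wedge] linear_cmul[OF linear_acts_as])
  next
    case (dform g \<rho>s)
    show ?case
    proof (rule wedge_dform_local[OF LIPb_bcontfun[OF f] \<pi>s dform])
      show "((\<pi>s @ \<rho>s) ! j) x = c" if "x \<in> U" for x
        using \<pi>s U(1) U(4)[OF that] by (auto simp: LIP_tuples_def nth_append)
    qed (use f U in auto)
  qed
  have "mass_bound n (\<lambda>f \<pi>s. ?M (dform f \<pi>s)) (density ?\<mu> ?h)"
    "current n (\<lambda>f \<pi>s. ?M (dform f \<pi>s))" "acts_as n (\<lambda>f \<pi>s. ?M (dform f \<pi>s)) ?M"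
    by (rule current_of_linear[OF n lin fin sets]; fact bound cont loc)+
  from acts_as_le_seminorm_mass[OF v this(2,3,1)]
  have "\<bar>?M v\<bar> \<le> seminorm n v * measure (density ?\<mu> ?h) UNIV" .
  also have "measure (density ?\<mu> ?h) UNIV = (\<integral>x. ?h x \<partial>?\<mu>)"
    by (rule measure_density_UNIV[OF finite_AK_mass(2) hm h0])
  also have "\<dots> = seminorm m w * measure ?\<mu> UNIV"
    by (simp add: sets_eq_imp_space_eq[OF finite_AK_mass(2)])
  finally show ?thesis .
qed

end

lemma metric_forms_subset_forms:
  assumes "V \<in> metric_forms k" "v \<in> V"
  shows "v \<in> forms k"
  using assms unfolding metric_forms_def by (auto elim!: quotientE)

theorem proposition1p40:
  fixes V W :: "'a::polish_space tensor set" and v w :: "'a tensor" and n m :: nat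
  assumes "n \<ge> 1" and "m \<ge> 1"
    and "V \<in> metric_forms n" and "W \<in> metric_forms m"
    and "v \<in> V" and "w \<in> W"
  shows "seminorm (n + m) (wedge v w) \<le> seminorm n v * seminorm m w"
  unfolding seminorm_def[of "n + m"]
proof (rule cSup_least)
  have v: "v \<in> forms n" and w: "w \<in> forms m" using assms metric_forms_subset_forms by blast+
  \<comment> \<open>\<open>cSup_least\<close> needs a nonempty set; the zero current in degree n + m
    provides an element.\<close>
  show "{L (wedge v w) |T L. current (n + m) T \<and> measure (AK_mass (n + m) T) UNIV \<le> 1 \<and>
      acts_as (n + m) T L} \<noteq> {}"
    using zero_current[of "n + m"] assms(1) by fastforce
  fix y assume "y \<in> {L (wedge v w) |T L. current (n + m) T \<and> measure (AK_mass (n + m) T) UNIV \<le> 1 \<and>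
      acts_as (n + m) T L}"
  then obtain T L where y: "y = L (wedge v w)" and T: "current (n + m) T"
    and mass: "measure (AK_mass (n + m) T) UNIV \<le> 1" and L: "acts_as (n + m) T L" by (elim CollectE exE conjE)
  note nn = seminorm_nonneg[OF assms(1) v] seminorm_nonneg[OF assms(2) w]
  have "y \<le> seminorm n v * (seminorm m w * measure (AK_mass (n + m) T) UNIV)"
    using wedge_forms_le[OF T L assms(1,2) v w] by (simp add: y)
  also have "\<dots> \<le> seminorm n v * (seminorm m w * 1)"
    by (intro mult_left_mono mass nn)
  finally show "y \<le> seminorm n v * seminorm m w" by simp
qed

end
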